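(* The minimal faithful permutation degree of the Coxeter group of type $H_4$ is $120$, that is, $\mu(W(H_4))=120$.
   Context: For a finite group $G$, $\mu(G)$ denotes the minimal faithful permutation degree of $G$: the least non-negative integer $m$ such that $G$ embeds in the symmetric group $\mathrm{Sym}(m)$. $W(H_4)$ denotes the finite irreducible Coxeter group of type $H_4$ (Coxeter diagram a path on $4$ vertices with consecutive edge labels $5,3,3$), of order $14400$. *)

theory Defs
  imports "HOL-Algebra.Sym_Groups"
begin

section \<open>Groups given by generators and relators\<close>

text \<open>The letter \<open>(x, True)\<close> stands for the generator \<open>x\<close>, and \<open>(x, False)\<close> for its formal inverse.\<close>

type_synonym 'a word = "('a \<times> bool) list"

definition words :: "'a set \<Rightarrow> 'a word set"
  where "words S = lists (S \<times> UNIV)"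

inductive_set word_cong :: "'a set \<Rightarrow> 'a word set \<Rightarrow> ('a word \<times> 'a word) set"
  for S :: "'a set" and R :: "'a word set"
  where
    refl: "u \<in> words S \<Longrightarrow> (u, u) \<in> word_cong S R"
  | sym: "(u, v) \<in> word_cong S R \<Longrightarrow> (v, u) \<in> word_cong S R"
  | trans: "(u, v) \<in> word_cong S R \<Longrightarrow> (v, w) \<in> word_cong S R \<Longrightarrow> (u, w) \<in> word_cong S R"
  | cancel: "u \<in> words S \<Longrightarrow> v \<in> words S \<Longrightarrow> x \<in> S \<Longrightarrow>
      (u @ [(x, b), (x, \<not> b)] @ v, u @ v) \<in> word_cong S R"
  | relator: "u \<in> words S \<Longrightarrow> v \<in> words S \<Longrightarrow> r \<in> R \<Longrightarrow> r \<in> words S \<Longrightarrow>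
      (u @ r @ v, u @ v) \<in> word_cong S R"

definition presented_group :: "'a set \<Rightarrow> 'a word set \<Rightarrow> 'a word set monoid"
  where "presented_group S R =
    \<lparr> carrier = words S // word_cong S R,
      mult = (\<lambda>A B. \<Union>a\<in>A. \<Union>b\<in>B. word_cong S R `` {a @ b}),
      one = word_cong S R `` {[]} \<rparr>"

section \<open>Coxeter groups\<close>

text \<open>The value \<open>m i j = 0\<close> encodes the label infinity: the relator is then the empty word.\<close>

definition coxeter_relators :: "'a set \<Rightarrow> ('a \<Rightarrow> 'a \<Rightarrow> nat) \<Rightarrow> 'a word set"
  where "coxeter_relators S m =
    {concat (replicate (m i j) [(i, True), (j, True)]) | i j. i \<in> S \<and> j \<in> S}"

definition coxeter_group :: "'a set \<Rightarrow> ('a \<Rightarrow> 'a \<Rightarrow> nat) \<Rightarrow> 'a word set monoid"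
  where "coxeter_group S m = presented_group S (coxeter_relators S m)"

definition coxeter_matrix_H4 :: "nat \<Rightarrow> nat \<Rightarrow> nat"
  where "coxeter_matrix_H4 i j =
    (if i = j then 1
     else if {i, j} = {1, 2} then 5
     else if {i, j} = {2, 3} \<or> {i, j} = {3, 4} then 3
     else 2)"

definition W_H4 :: "nat word set monoid"
  where "W_H4 = coxeter_group {1..4} coxeter_matrix_H4"

section \<open>Minimal faithful permutation degree\<close>

text \<open>Meaningful for finite groups, for which the set of such \<open>m\<close> is nonempty by Cayley's theorem;
  \<^term>\<open>mon\<close> is the set of injective homomorphisms.\<close>

definition min_faithful_perm_degree :: "('a, 'b) monoid_scheme \<Rightarrow> nat"
  where "min_faithful_perm_degree G = (LEAST m. mon G (sym_group m) \<noteq> {})"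

section \<open>Presented groups are groups\<close>

lemma words_append [simp]: "u @ v \<in> words S \<longleftrightarrow> u \<in> words S \<and> v \<in> words S"
  by (auto simp: words_def)

lemma words_Nil [simp]: "[] \<in> words S"
  by (simp add: words_def)

lemma words_Cons [simp]: "(x, b) # u \<in> words S \<longleftrightarrow> x \<in> S \<and> u \<in> words S"
  by (simp add: words_def)

lemma word_cong_words: "(u, v) \<in> word_cong S R \<Longrightarrow> u \<in> words S \<and> v \<in> words S"
  by (induction rule: word_cong.induct) auto

lemma equiv_word_cong: "equiv (words S) (word_cong S R)"
  by (rule equivI)
    (auto simp: refl_on_def intro!: symI transI word_cong.refl
      dest: word_cong_words intro: word_cong.sym word_cong.trans)

lemma word_cong_context:
  "(u, v) \<in> word_cong S R \<Longrightarrow> p \<in> words S \<Longrightarrow> q \<in> words S \<Longrightarrow>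
    (p @ u @ q, p @ v @ q) \<in> word_cong S R"
proof (induction rule: word_cong.induct)
  case (cancel u v x b)
  then show ?case
    using word_cong.cancel[of "p @ u" S "v @ q" x b R] by simp
next
  case (relator u v r)
  then show ?case
    using word_cong.relator[of "p @ u" S "v @ q" r R] by simp
qed (auto intro: word_cong.intros)

lemma word_cong_append:
  assumes "(u, u') \<in> word_cong S R" "(v, v') \<in> word_cong S R"
  shows "(u @ v, u' @ v') \<in> word_cong S R"
  using word_cong_context[OF assms(1), of "[]" v] word_cong_context[OF assms(2), of u' "[]"]
    word_cong_words[OF assms(1)] word_cong_words[OF assms(2)]
  by (auto intro: word_cong.trans)

lemma presented_group_mult:
  assumes "u \<in> words S" "v \<in> words S"
  shows "word_cong S R `` {u} \<otimes>\<^bsub>presented_group S R\<^esub> word_cong S R `` {v} = word_cong S R `` {u @ v}"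
proof -
  have "word_cong S R `` {a @ b} = word_cong S R `` {u @ v}"
    if "a \<in> word_cong S R `` {u}" "b \<in> word_cong S R `` {v}" for a b
    using that equiv_class_eq[OF equiv_word_cong word_cong_append] by blast
  moreover have "u \<in> word_cong S R `` {u}" "v \<in> word_cong S R `` {v}"
    using assms by (auto intro: word_cong.refl)
  ultimately show ?thesis
    unfolding presented_group_def monoid.simps by blast
qed

definition word_inv :: "'a word \<Rightarrow> 'a word"
  where "word_inv u = rev (map (\<lambda>(x, b). (x, \<not> b)) u)"

lemma word_inv_words: "u \<in> words S \<Longrightarrow> word_inv u \<in> words S"
  by (auto simp: word_inv_def words_def)

lemma word_inv_cancel: "u \<in> words S \<Longrightarrow> (word_inv u @ u, []) \<in> word_cong S R"
proof (induction u)
  case (Cons a u)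
  obtain x b where a: "a = (x, b)" by force
  have "(word_inv u @ [(x, \<not> b), (x, \<not> \<not> b)] @ u, word_inv u @ u) \<in> word_cong S R"
    using Cons.prems word_inv_words[of u S] by (intro word_cong.cancel) (auto simp: a)
  then show ?case
    using Cons by (auto simp: a word_inv_def intro: word_cong.trans)
qed (auto simp: word_inv_def intro: word_cong.refl)

lemma group_presented_group: "group (presented_group S R)"
proof (rule groupI)
  let ?G = "presented_group S R"
  have carr: "\<exists>u\<in>words S. A = word_cong S R `` {u}" if "A \<in> carrier ?G" for A
    using that by (auto simp: presented_group_def elim: quotientE)
  have cls: "word_cong S R `` {u} \<in> carrier ?G" if "u \<in> words S" for u
    using that by (auto simp: presented_group_def intro: quotientI)
  have one: "\<one>\<^bsub>?G\<^esub> = word_cong S R `` {[]}"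
    by (simp add: presented_group_def)
  show "\<one>\<^bsub>?G\<^esub> \<in> carrier ?G"
    using cls one by simp
  fix A assume "A \<in> carrier ?G"
  then obtain u where u: "u \<in> words S" "A = word_cong S R `` {u}"
    using carr by blast
  show "\<one>\<^bsub>?G\<^esub> \<otimes>\<^bsub>?G\<^esub> A = A"
    using u by (simp add: one presented_group_mult)
  show "\<exists>B\<in>carrier ?G. B \<otimes>\<^bsub>?G\<^esub> A = \<one>\<^bsub>?G\<^esub>"
    using u cls[OF word_inv_words[OF u(1)]]
      equiv_class_eq[OF equiv_word_cong word_inv_cancel[OF u(1), of R]]
    by (intro bexI[of _ "word_cong S R `` {word_inv u}"])
      (simp_all add: one presented_group_mult word_inv_words)
  fix B assume "B \<in> carrier ?G"
  then obtain v where v: "v \<in> words S" "B = word_cong S R `` {v}"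
    using carr by blast
  show "A \<otimes>\<^bsub>?G\<^esub> B \<in> carrier ?G"
    using u v cls by (simp add: presented_group_mult)
  fix C assume "C \<in> carrier ?G"
  then obtain w where "w \<in> words S" "C = word_cong S R `` {w}"
    using carr by blast
  then show "A \<otimes>\<^bsub>?G\<^esub> B \<otimes>\<^bsub>?G\<^esub> C = A \<otimes>\<^bsub>?G\<^esub> (B \<otimes>\<^bsub>?G\<^esub> C)"
    using u v by (simp add: presented_group_mult)
qed

lemma group_W_H4: "group W_H4"
  by (simp add: W_H4_def coxeter_group_def group_presented_group)

end

theory Submission
  imports Defs
begin

text \<open>The 120 roots of \<open>H\<^sub>4\<close> are the unit icosians, that is, the binary icosahedral group inside the
quaternions, and the reflection in the root \<open>r\<close> is \<open>x \<mapsto> - r x' r\<close>, where \<open>x'\<close> is the conjugate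
quaternion. Reducing the icosians modulo the square root of 5 gives the ring of \<open>2 \<times> 2\<close> matrices over
\<open>F\<^sub>5\<close>; conjugation becomes the adjugate, and the 120 units map bijectively onto \<open>SL(2,5)\<close>. So the
Coxeter group \<open>W\<close> acts on the matrix ring by \<open>x \<mapsto> - r (adj x) r\<close>, preserving \<open>SL(2,5)\<close>, and every
question about \<open>W\<close> turns into a finite computation over \<open>F\<^sub>5\<close>.

Upper bound. The action on the 120 elements of \<open>SL(2,5)\<close> is faithful. The point stabilizers form a
chain of parabolic subgroups of types \<open>H\<^sub>3\<close>, \<open>I\<^sub>2(5)\<close>, \<open>A\<^sub>1\<close> and the trivial group: the stabilizer
of a suitable point in the subgroup generated by some of the generators is generated by those
generators that fix the point. Since \<open>W\<close> is only given by a presentation, each such claim says that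
every closed walk in a Schreier graph can be contracted, through relators, to loops at the base
point. This is what a coset enumeration shows; the lemma \<open>point_stabilizer_parabolic\<close> extracts it from
a check of the edges of the graph, ordered by their distance from the base point.

Lower bound. The image of \<open>W\<close> contains all maps \<open>x \<mapsto> a x b\<^sup>-\<^sup>1\<close> with \<open>a\<close> and \<open>b\<close> in \<open>SL(2,5)\<close>, because the
sixth power of a Coxeter element is a left multiplication by a transvection, and its conjugates
generate the rest. So \<open>SL(2,5) \<times> SL(2,5)\<close>, of order \<open>120 * 120\<close>, acts on the points of any faithful
permutation representation of \<open>W\<close>, and \<open>(-1, 1)\<close>, which is the central element \<open>-1\<close> of \<open>W\<close>, moves some
point. The stabilizer \<open>H\<close> of that point contains neither \<open>(-1, 1)\<close> nor \<open>(1, -1)\<close>, and the lemma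
\<open>card_subgroup_avoiding_minus_one\<close> shows \<open>card H \<le> 120\<close> by an argument in the style of Goursat: the
intersections of \<open>H\<close> with the two factors avoid \<open>-1\<close>, and a nontrivial subgroup of \<open>SL(2,5)\<close> avoiding
\<open>-1\<close> is so small, and has so small a normalizer, that \<open>H\<close> must be small too. Hence the orbit of the
point has at least 120 elements.\<close>

section \<open>Two by two matrices over the field with five elements\<close>

text \<open>The arithmetic is given by constructor equations so that concrete statements about matrices can be
evaluated by rewriting.\<close>

datatype z5 = Z0 | Z1 | Z2 | Z3 | Z4

fun z5_succ :: "z5 \<Rightarrow> z5" where
  "z5_succ Z0 = Z1" | "z5_succ Z1 = Z2" | "z5_succ Z2 = Z3" | "z5_succ Z3 = Z4" | "z5_succ Z4 = Z0"

instantiation z5 :: field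
begin

fun uminus_z5 :: "z5 \<Rightarrow> z5" where
  "- Z0 = Z0" | "- Z1 = Z4" | "- Z2 = Z3" | "- Z3 = Z2" | "- Z4 = Z1"

fun plus_z5 :: "z5 \<Rightarrow> z5 \<Rightarrow> z5" where
  "Z0 + y = y"
| "Z1 + y = z5_succ y"
| "Z2 + y = z5_succ (z5_succ y)"
| "Z3 + y = z5_succ (z5_succ (z5_succ y))"
| "Z4 + y = z5_succ (z5_succ (z5_succ (z5_succ y)))"

fun times_z5 :: "z5 \<Rightarrow> z5 \<Rightarrow> z5" where
  "Z0 * y = Z0" | "Z1 * y = y" | "Z2 * y = y + y" | "Z3 * y = - (y + y)" | "Z4 * y = - y"

fun inverse_z5 :: "z5 \<Rightarrow> z5" where
  "inverse Z0 = Z0" | "inverse Z1 = Z1" | "inverse Z2 = Z3" | "inverse Z3 = Z2" | "inverse Z4 = Z4"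

definition zero_z5 :: z5 where "0 = Z0"
definition one_z5 :: z5 where "1 = Z1"
definition minus_z5 :: "z5 \<Rightarrow> z5 \<Rightarrow> z5" where "(x::z5) - y = x + - y"
definition divide_z5 :: "z5 \<Rightarrow> z5 \<Rightarrow> z5" where "(x::z5) div y = x * inverse y"

instance
proof
  fix a b c :: z5
  show "a + b + c = a + (b + c)" "a * b * c = a * (b * c)" "(a + b) * c = a * c + b * c"
    by (cases a; cases b; cases c; simp)+
  show "a + b = b + a" "a * b = b * a" "a - b = a + - b" "a div b = a * inverse b"
    by (cases a; cases b; simp add: minus_z5_def divide_z5_def)+
  show "0 + a = a" "- a + a = 0" "1 * a = a" "inverse (0::z5) = 0"
    by (cases a; simp add: zero_z5_def one_z5_def)+
  show "(0::z5) \<noteq> 1"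
    by (simp add: zero_z5_def one_z5_def)
  assume "a \<noteq> 0"
  then show "inverse a * a = 1"
    by (cases a) (simp_all add: zero_z5_def one_z5_def)
qed

end

datatype mat2 = Mat z5 z5 z5 z5

instantiation mat2 :: ring_1
begin

fun plus_mat2 :: "mat2 \<Rightarrow> mat2 \<Rightarrow> mat2" where
  "Mat a b c d + Mat a' b' c' d' = Mat (a + a') (b + b') (c + c') (d + d')"
fun uminus_mat2 :: "mat2 \<Rightarrow> mat2" where
  "- Mat a b c d = Mat (- a) (- b) (- c) (- d)"
fun times_mat2 :: "mat2 \<Rightarrow> mat2 \<Rightarrow> mat2" where
  "Mat a b c d * Mat a' b' c' d' =
     Mat (a * a' + b * c') (a * b' + b * d') (c * a' + d * c') (c * b' + d * d')"
definition zero_mat2 :: mat2 where "0 = Mat 0 0 0 0"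
definition one_mat2 :: mat2 where "1 = Mat 1 0 0 1"
definition minus_mat2 :: "mat2 \<Rightarrow> mat2 \<Rightarrow> mat2" where "(x::mat2) - y = x + - y"

instance
proof
  fix x y z :: mat2
  show "x + y + z = x + (y + z)" "x * y * z = x * (y * z)"
    "(x + y) * z = x * z + y * z" "x * (y + z) = x * y + x * z"
    by (cases x; cases y; cases z; simp add: algebra_simps)+
  show "x + y = y + x" "x - y = x + - y"
    by (cases x; cases y; simp add: minus_mat2_def)+
  show "0 + x = x" "- x + x = 0" "1 * x = x" "x * 1 = x" "(0::mat2) \<noteq> 1"
    by (cases x; simp add: zero_mat2_def one_mat2_def)+
qed

end

text \<open>The adjugate is the reduction of the conjugation of quaternions, and the determinant that of the norm.\<close>

fun adj :: "mat2 \<Rightarrow> mat2" where "adj (Mat a b c d) = Mat d (- b) (- c) a"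
fun det2 :: "mat2 \<Rightarrow> z5" where "det2 (Mat a b c d) = a * d - b * c"
fun trace2 :: "mat2 \<Rightarrow> z5" where "trace2 (Mat a b c d) = a + d"

definition SL25 :: "mat2 set" where "SL25 = {x. det2 x = 1}"

lemma adj_mult: "adj (x * y) = adj y * adj x"
  by (cases x; cases y) (simp add: algebra_simps)

lemma adj_uminus [simp]: "adj (- x) = - adj x"
  by (cases x) simp

lemma adj_adj [simp]: "adj (adj x) = x"
  by (cases x) simp

lemma det2_mult [simp]: "det2 (x * y) = det2 x * det2 y"
  by (cases x; cases y) (simp add: algebra_simps)

lemma det2_adj [simp]: "det2 (adj x) = det2 x"
  by (cases x) (simp add: algebra_simps)

lemma det2_uminus [simp]: "det2 (- x) = det2 x"
  by (cases x) simp

lemma mult_adj: "x \<in> SL25 \<Longrightarrow> x * adj x = 1" "x \<in> SL25 \<Longrightarrow> adj x * x = 1"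
  by (cases x; simp add: SL25_def one_mat2_def algebra_simps)+

lemma SL25_closed: "x \<in> SL25 \<Longrightarrow> y \<in> SL25 \<Longrightarrow> x * y \<in> SL25" "x \<in> SL25 \<Longrightarrow> adj x \<in> SL25"
  "x \<in> SL25 \<Longrightarrow> - x \<in> SL25" "1 \<in> SL25"
  by (auto simp: SL25_def one_mat2_def)

definition z5_list :: "z5 list" where "z5_list = [Z0, Z1, Z2, Z3, Z4]"
definition SL25_list :: "mat2 list" where
  "SL25_list = [x. a \<leftarrow> z5_list, b \<leftarrow> z5_list, c \<leftarrow> z5_list, d \<leftarrow> z5_list, x \<leftarrow> [Mat a b c d], det2 x = 1]"

lemma z5_list: "set z5_list = UNIV"
proof -
  have "x \<in> set z5_list" for x by (cases x) (auto simp: z5_list_def)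
  then show ?thesis by blast
qed

lemma set_SL25_list: "set SL25_list = SL25"
proof -
  have "x \<in> set SL25_list \<longleftrightarrow> det2 x = 1" for x
    unfolding SL25_list_def by (cases x) (auto simp: z5_list)
  then show ?thesis by (auto simp: SL25_def)
qed

lemma card_SL25: "card SL25 = 120"
proof -
  have "distinct SL25_list \<and> length SL25_list = 120" by code_simp
  then show ?thesis using distinct_card[of SL25_list] set_SL25_list by simp
qed

lemma finite_SL25: "finite SL25"
  using set_SL25_list by (metis List.finite_set)

section \<open>Coxeter groups acting on a set\<close>

fun alternating :: "nat \<Rightarrow> 'a \<Rightarrow> 'a \<Rightarrow> 'a list" where
  "alternating 0 s t = []"
| "alternating (Suc n) s t = s # alternating n t s"

lemma alternating_even: "alternating (2 * n) s t = concat (replicate n [s, t])"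
  by (induction n) auto

text \<open>All labels are required to be finite, so that every relator can be solved for one of its letters.
The generators being involutions, words without formal inverses suffice.\<close>

locale coxeter_action =
  fixes S :: "'a set" and m :: "'a \<Rightarrow> 'a \<Rightarrow> nat" and \<sigma> :: "'a \<Rightarrow> 'p \<Rightarrow> 'p"
  assumes diagonal: "i \<in> S \<Longrightarrow> m i i = 1"
    and finite_label: "i \<in> S \<Longrightarrow> j \<in> S \<Longrightarrow> 0 < m i j"
    and relator_acts_trivially:
      "i \<in> S \<Longrightarrow> j \<in> S \<Longrightarrow> foldr \<sigma> (concat (replicate (m i j) [i, j])) p = p"
begin

abbreviation act :: "'a list \<Rightarrow> 'p \<Rightarrow> 'p" where "act \<equiv> foldr \<sigma>"

definition positive :: "'a list \<Rightarrow> 'a word" where "positive = map (\<lambda>i. (i, True))"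

definition word_eq :: "'a list \<Rightarrow> 'a list \<Rightarrow> bool"  (infix "\<simeq>" 50) where
  "u \<simeq> v \<longleftrightarrow> (positive u, positive v) \<in> word_cong S (coxeter_relators S m)"

lemma act_involution: "i \<in> S \<Longrightarrow> \<sigma> i (\<sigma> i p) = p"
  using relator_acts_trivially[of i i p] by (simp add: diagonal)

lemma word_cong_act:
  "(u, v) \<in> word_cong S (coxeter_relators S m) \<Longrightarrow> act (map fst u) = act (map fst v)"
proof (induction rule: word_cong.induct)
  case (cancel u v x b)
  then show ?case by (auto simp: fun_eq_iff act_involution)
next
  case (relator u v r)
  then obtain i j where "i \<in> S" "j \<in> S" "r = concat (replicate (m i j) [(i, True), (j, True)])"
    by (auto simp: coxeter_relators_def)
  moreover have "map fst (concat (replicate n [(i, True), (j, True)])) = concat (replicate n [i, j])" for n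
    by (induction n) auto
  ultimately show ?case
    by (auto simp: fun_eq_iff relator_acts_trivially)
qed auto

lemma map_fst_positive [simp]: "map fst (positive w) = w"
  by (simp add: positive_def comp_def)

lemma positive_words [simp]: "positive w \<in> words S \<longleftrightarrow> set w \<subseteq> S"
  by (auto simp: positive_def words_def lists_eq_set)

lemma word_eq_act: "u \<simeq> v \<Longrightarrow> act u = act v"
  using word_cong_act[of "positive u" "positive v"] by (simp add: word_eq_def)

lemma word_eq_refl: "set w \<subseteq> S \<Longrightarrow> w \<simeq> w"
  by (simp add: word_eq_def word_cong.refl)

lemma word_eq_sym: "u \<simeq> v \<Longrightarrow> v \<simeq> u"
  by (simp add: word_eq_def word_cong.sym)

lemma word_eq_trans [trans]: "u \<simeq> v \<Longrightarrow> v \<simeq> w \<Longrightarrow> u \<simeq> w"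
  by (auto simp: word_eq_def intro: word_cong.trans)

lemma word_eq_set: "u \<simeq> v \<Longrightarrow> set u \<subseteq> S" "u \<simeq> v \<Longrightarrow> set v \<subseteq> S"
  unfolding word_eq_def by (auto dest!: word_cong_words)

lemma word_eq_context: "u \<simeq> v \<Longrightarrow> set p \<subseteq> S \<Longrightarrow> set q \<subseteq> S \<Longrightarrow> p @ u @ q \<simeq> p @ v @ q"
  using word_cong_context[of "positive u" "positive v" S _ "positive p" "positive q"]
  by (auto simp: word_eq_def positive_def[abs_def] simp flip: positive_words)

lemma word_eq_relator: "i \<in> S \<Longrightarrow> j \<in> S \<Longrightarrow> concat (replicate (m i j) [i, j]) \<simeq> []"
proof -
  assume ij: "i \<in> S" "j \<in> S"
  have *: "positive (concat (replicate n [i, j])) = concat (replicate n [(i, True), (j, True)])" for n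
    by (induction n) (auto simp: positive_def)
  have "set (concat (replicate (m i j) [i, j])) \<subseteq> S"
    using ij by auto
  then have "positive (concat (replicate (m i j) [i, j])) \<in> words S" by simp
  moreover have "positive (concat (replicate (m i j) [i, j])) \<in> coxeter_relators S m"
    unfolding coxeter_relators_def * using ij by blast
  ultimately show ?thesis
    using word_cong.relator[of "[]" S "[]" "positive (concat (replicate (m i j) [i, j]))" "coxeter_relators S m"]
    unfolding word_eq_def positive_def by simp
qed

lemma word_eq_square: "i \<in> S \<Longrightarrow> [i, i] \<simeq> []"
  using word_eq_relator[of i i] by (simp add: diagonal)

lemma word_eq_cancel: "i \<in> S \<Longrightarrow> set w \<subseteq> S \<Longrightarrow> i # i # w \<simeq> w"
  using word_eq_context[OF word_eq_square, of i "[]" w] by simp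

lemma word_eq_Cons: "u \<simeq> v \<Longrightarrow> i \<in> S \<Longrightarrow> i # u \<simeq> i # v"
  using word_eq_context[of u v "[i]" "[]"] by simp

lemma word_eq_rev: "set w \<subseteq> S \<Longrightarrow> w @ rev w \<simeq> []"
proof (induction w)
  case (Cons i w)
  then have "[i] @ (w @ rev w) @ [i] \<simeq> [i] @ [] @ [i]"
    by (intro word_eq_context) auto
  then show ?case
    using Cons.prems word_eq_square[of i] by (auto intro: word_eq_trans)
qed (simp add: word_eq_refl)

lemma word_eq_alternating:
  assumes "i \<in> S" "t \<in> S"
  shows "rev (alternating (2 * m i t - 1) t i) \<simeq> [i]"
proof -
  let ?W = "alternating (2 * m i t - 1) t i"
  have "alternating (2 * m i t) i t = i # ?W"
    using finite_label[OF assms] by (cases "m i t") auto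
  then have 1: "i # ?W \<simeq> []"
    using word_eq_relator[OF assms] by (simp add: alternating_even)
  then have W: "set ?W \<subseteq> S"
    using word_eq_set(1) by fastforce
  have "rev (i # ?W) @ (i # ?W) @ [] \<simeq> rev (i # ?W) @ [] @ []"
    using 1 W assms by (intro word_eq_context) auto
  moreover have "rev (i # ?W) @ rev (rev (i # ?W)) \<simeq> []"
    using W assms by (intro word_eq_rev) auto
  ultimately have "rev (i # ?W) \<simeq> []"
    by (auto intro: word_eq_trans word_eq_sym)
  then have 2: "rev ?W @ [i] @ [i] \<simeq> [i]"
    using word_eq_context[of "rev (i # ?W)" "[]" "[]" "[i]"] assms by simp
  have "rev ?W @ [i, i] @ [] \<simeq> rev ?W @ [] @ []"
    using W assms word_eq_square by (intro word_eq_context) auto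
  then show ?thesis
    using 2 by (auto intro: word_eq_trans word_eq_sym)
qed

lemma word_cong_positive:
  "u \<in> words S \<Longrightarrow> (u, positive (map fst u)) \<in> word_cong S (coxeter_relators S m)"
proof (induction u)
  case (Cons a u)
  let ?R = "word_cong S (coxeter_relators S m)"
  obtain i b where a: "a = (i, b)" by force
  have i: "i \<in> S" and u: "u \<in> words S" using Cons.prems by (auto simp: a)
  have "([(i, b)], [(i, True)]) \<in> ?R"
  proof (cases b)
    case False
    have "([(i, False)] @ positive [i, i] @ [], [(i, False)] @ positive [] @ []) \<in> ?R"
      using word_eq_square[OF i] i unfolding word_eq_def by (intro word_cong_context) auto
    moreover have "([] @ [(i, False), (i, \<not> False)] @ [(i, True)], [] @ [(i, True)]) \<in> ?R"
      using i by (intro word_cong.cancel) auto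
    ultimately show ?thesis
      using False by (auto simp: positive_def intro: word_cong.sym word_cong.trans)
  qed (simp add: i word_cong.refl)
  then have "([(i, b)] @ u, [(i, True)] @ positive (map fst u)) \<in> ?R"
    using Cons.IH[OF u] by (rule word_cong_append)
  then show ?case by (simp add: a positive_def)
qed (simp add: positive_def word_cong.refl)

end

section \<open>Coset enumeration certificates\<close>

text \<open>A table assigns to each point its distance from the base point and the generator leading one step
back. The edge with label \<open>i\<close> between points with entries \<open>(k, s)\<close> and \<open>(l, t)\<close> is known at level \<open>b\<close>
if both ends are closer than \<open>b\<close>, or if it belongs to the spanning tree given by the table.\<close>

fun edge_known :: "int \<Rightarrow> 'a \<Rightarrow> int \<times> 'a \<Rightarrow> int \<times> 'a \<Rightarrow> bool" where
  "edge_known b i (k, s) (l, t) \<longleftrightarrow> k < b \<and> l < b \<or> k < l \<and> i = t \<or> l < k \<and> i = s"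

fun path_known :: "('a \<Rightarrow> 'p \<Rightarrow> 'p) \<Rightarrow> ('p \<Rightarrow> int \<times> 'a) \<Rightarrow> int \<Rightarrow> 'p \<Rightarrow> 'a list \<Rightarrow> bool" where
  "path_known \<sigma> T b p [] \<longleftrightarrow> True"
| "path_known \<sigma> T b p (i # w) \<longleftrightarrow> edge_known b i (T p) (T (\<sigma> i p)) \<and> path_known \<sigma> T b (\<sigma> i p) w"

text \<open>A non-tree edge at \<open>p\<close> with label \<open>i\<close> is contracted through the relator of \<open>i\<close> and \<open>t\<close>, where \<open>t\<close> is
the tree label at \<open>p\<close>: the remaining letters of the relator must run along known edges. The truth
value is matched on in order that rewriting expands the path only for edges to be checked.\<close>

fun edge_ok :: "('a \<Rightarrow> 'p \<Rightarrow> 'p) \<Rightarrow> ('a \<Rightarrow> 'a \<Rightarrow> nat) \<Rightarrow>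
    ('p \<Rightarrow> int \<times> 'a) \<Rightarrow> int \<Rightarrow> 'p \<Rightarrow> 'a \<Rightarrow> 'a \<Rightarrow> bool \<Rightarrow> bool" where
  "edge_ok \<sigma> m T k p t i False \<longleftrightarrow> True"
| "edge_ok \<sigma> m T k p t i True \<longleftrightarrow> path_known \<sigma> T k p (alternating (2 * m i t - 1) t i)"

fun vertex_ok :: "('a \<Rightarrow> 'p \<Rightarrow> 'p) \<Rightarrow> ('a \<Rightarrow> 'a \<Rightarrow> nat) \<Rightarrow>
    ('p \<Rightarrow> int \<times> 'a) \<Rightarrow> 'a list \<Rightarrow> 'p \<Rightarrow> int \<times> 'a \<Rightarrow> bool" where
  "vertex_ok \<sigma> m T I p (k, t) \<longleftrightarrow> 0 < k \<and> t \<in> set I \<and> fst (T (\<sigma> t p)) = k - 1 \<and>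
     list_all (\<lambda>i. edge_ok \<sigma> m T k p t i (fst (T (\<sigma> i p)) \<le> k \<and> i \<noteq> t)) I"

definition table_ok :: "('a \<Rightarrow> 'p \<Rightarrow> 'p) \<Rightarrow> ('a \<Rightarrow> 'a \<Rightarrow> nat) \<Rightarrow>
    ('p \<Rightarrow> int \<times> 'a) \<Rightarrow> 'a list \<Rightarrow> 'a list \<Rightarrow> 'p \<Rightarrow> 'p list \<Rightarrow> bool" where
  "table_ok \<sigma> m T I J x P \<longleftrightarrow> fst (T x) = 0 \<and>
     list_all (\<lambda>i. i \<in> set J \<and> \<sigma> i x = x \<or> 0 < fst (T (\<sigma> i x))) I \<and>
     list_all (\<lambda>p. p = x \<or> vertex_ok \<sigma> m T I p (T p)) P"

context coxeter_action
begin

text \<open>Every point \<open>p\<close> has a tree word \<open>u p\<close> leading from \<open>x\<close> to \<open>p\<close>. An edge is harmless if following it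
after the tree word of its start agrees, up to a word over \<open>J\<close> on the right, with the tree word of
its end. Tree edges are harmless by the construction of \<open>u\<close>, and the table certifies by induction on
the distance that all edges are. Then every word over \<open>I\<close> is a tree word followed by a word over \<open>J\<close>, and the tree word is
empty if the word fixes \<open>x\<close>.\<close>

theorem point_stabilizer_parabolic:
  assumes ok: "table_ok \<sigma> m T I J x P"
    and IS: "set I \<subseteq> S" and JS: "set J \<subseteq> S"
    and x: "x \<in> set P" and closed: "\<And>p i. p \<in> set P \<Longrightarrow> i \<in> set I \<Longrightarrow> \<sigma> i p \<in> set P"
    and w: "set w \<subseteq> set I" "act w x = x"
  shows "\<exists>v. set v \<subseteq> set J \<and> w \<simeq> v"
proof -
  define dep where "dep p = fst (T p)" for p
  define par where "par p = snd (T p)" for p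
  have T: "T p = (dep p, par p)" for p
    by (simp add: dep_def par_def)
  have dep_x: "dep x = 0"
    using ok by (simp add: table_ok_def dep_def)
  have base: "i \<in> set J \<and> \<sigma> i x = x \<or> 0 < dep (\<sigma> i x)" if "i \<in> set I" for i
    using ok that by (auto simp: table_ok_def dep_def list_all_iff)
  have vertex: "vertex_ok \<sigma> m T I p (dep p, par p)" if "p \<in> set P" "p \<noteq> x" for p
    using ok that by (auto simp: table_ok_def list_all_iff T)
  have dep_pos: "0 < dep p" and par_I: "par p \<in> set I" and dep_par: "dep (\<sigma> (par p) p) = dep p - 1"
    if "p \<in> set P" "p \<noteq> x" for p
    using vertex[OF that] by (auto simp: dep_def)
  have dep_nonneg: "0 \<le> dep p" if "p \<in> set P" for p
    using dep_pos[OF that] dep_x by (cases "p = x") auto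
  have inv: "\<sigma> i (\<sigma> i p) = p" if "i \<in> set I" for i p
    using IS that by (auto intro: act_involution)

  \<comment> \<open>The tree words are built by recursion on an explicit bound for the distance.\<close>
  define U where "U = rec_nat (\<lambda>p. []) (\<lambda>n U p. if p = x then [] else par p # U (\<sigma> (par p) p))"
  define u where "u p = U (nat (dep p)) p" for p
  have u_x: "u x = []"
    by (simp add: u_def dep_x U_def)
  have u_par: "u p = par p # u (\<sigma> (par p) p)" if "p \<in> set P" "p \<noteq> x" for p
  proof -
    have "nat (dep p) = Suc (nat (dep (\<sigma> (par p) p)))"
      using dep_pos[OF that] dep_par[OF that] by simp
    then show ?thesis
      using that by (simp add: u_def U_def)
  qed
  have "set (U n p) \<subseteq> set I" if "p \<in> set P" for n p
    using that by (induction n arbitrary: p) (auto simp: U_def par_I closed)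
  then have u_S: "set (u p) \<subseteq> S" if "p \<in> set P" for p
    using IS that unfolding u_def by blast

  define harmless where "harmless p i \<longleftrightarrow> (\<exists>v. set v \<subseteq> set J \<and> i # u p \<simeq> u (\<sigma> i p) @ v)" for p i
  have harmless_sym: "harmless (\<sigma> i p) i" if p: "p \<in> set P" and i: "i \<in> set I" and "harmless p i" for p i
  proof -
    from \<open>harmless p i\<close> obtain v where v: "set v \<subseteq> set J" "i # u p \<simeq> u (\<sigma> i p) @ v"
      by (auto simp: harmless_def)
    have S: "i \<in> S" "set v \<subseteq> S" "set (u p) \<subseteq> S" "set (u (\<sigma> i p)) \<subseteq> S"
      using v IS JS i u_S p closed by auto
    have "(i # u (\<sigma> i p)) @ [] @ [] \<simeq> (i # u (\<sigma> i p)) @ (v @ rev v) @ []"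
      using S by (intro word_eq_context word_eq_sym[OF word_eq_rev]) auto
    also have "(i # u (\<sigma> i p)) @ (v @ rev v) @ [] = [i] @ (u (\<sigma> i p) @ v) @ rev v"
      by simp
    also have "\<dots> \<simeq> [i] @ (i # u p) @ rev v"
      using S by (intro word_eq_context word_eq_sym[OF v(2)]) auto
    also have "\<dots> = [] @ [i, i] @ (u p @ rev v)"
      by simp
    also have "\<dots> \<simeq> [] @ [] @ (u p @ rev v)"
      using S by (intro word_eq_context word_eq_square) auto
    finally have "i # u (\<sigma> i p) \<simeq> u p @ rev v"
      by simp
    then show ?thesis
      unfolding harmless_def inv[OF i] using v(1) by (intro exI[of _ "rev v"]) auto
  qed
  have harmless_tree: "harmless p (par p)" if p: "p \<in> set P" "p \<noteq> x" for p
  proof -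
    have "par p # par p # u (\<sigma> (par p) p) \<simeq> u (\<sigma> (par p) p)"
      using par_I[OF p] IS u_S[OF closed[OF p(1) par_I[OF p]]] by (intro word_eq_cancel) auto
    then show ?thesis
      unfolding harmless_def u_par[OF p] by (intro exI[of _ "[]"]) auto
  qed

  \<comment> \<open>Each edge is treated from its end with the larger distance.\<close>
  have down: "harmless p i" if "p \<in> set P" "i \<in> set I" "dep (\<sigma> i p) \<le> dep p" for p i
    using that
  proof (induction "nat (dep p)" arbitrary: p i rule: less_induct)
    case (less p i)
    have iS: "i \<in> S" using less.prems IS by blast
    consider "p = x" | "p \<noteq> x" "i = par p" | "p \<noteq> x" "i \<noteq> par p" by blast
    then show ?case
    proof cases
      case 1
      then have "i \<in> set J" "\<sigma> i x = x"
        using base[of i] less.prems dep_x by auto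
      then show ?thesis
        unfolding harmless_def using 1 u_x iS by (intro exI[of _ "[i]"]) (auto simp: word_eq_refl)
    next
      case 2
      then show ?thesis using harmless_tree less.prems by simp
    next
      case 3
      note p = less.prems(1) 3(1)
      have edge: "harmless q j" if q: "q \<in> set P" and j: "j \<in> set I"
        and e: "edge_known (dep p) j (T q) (T (\<sigma> j q))" for q j
      proof -
        have q': "\<sigma> j q \<in> set P" using closed q j by blast
        consider "dep q < dep p" "dep (\<sigma> j q) < dep p" "dep (\<sigma> j q) \<le> dep q"
          | "dep q < dep p" "dep (\<sigma> j q) < dep p" "dep q \<le> dep (\<sigma> j q)"
          | "dep q < dep (\<sigma> j q)" "j = par (\<sigma> j q)" | "dep (\<sigma> j q) < dep q" "j = par q"
          using e by (auto simp: T) linarith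
        then show ?thesis
        proof cases
          case 1
          then show ?thesis using less.hyps[of q j] q j dep_pos[OF p] by simp
        next
          case 2
          then have "harmless (\<sigma> j q) j"
            using less.hyps[of "\<sigma> j q" j] q' j dep_pos[OF p] by (simp add: inv)
          then show ?thesis using harmless_sym[OF q' j] inv[OF j] by simp
        next
          case 3
          then have "\<sigma> j q \<noteq> x" using dep_x dep_nonneg[OF q] by auto
          then have "harmless (\<sigma> j q) j" using harmless_tree[OF q'] 3 by simp
          then show ?thesis using harmless_sym[OF q' j] inv[OF j] by simp
        next
          case 4
          then have "q \<noteq> x" using dep_x dep_nonneg[OF q'] by auto
          then show ?thesis using harmless_tree[OF q] 4 by simp
        qed
      qed
      have path: "\<exists>v. set v \<subseteq> set J \<and> rev w @ u q \<simeq> u (act (rev w) q) @ v"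
        if "q \<in> set P" "set w \<subseteq> set I" "path_known \<sigma> T (dep p) q w" for q w
        using that
      proof (induction w arbitrary: q)
        case Nil
        then show ?case using u_S by (intro exI[of _ "[]"]) (auto simp: word_eq_refl)
      next
        case (Cons j w)
        have j: "j \<in> set I" and q': "\<sigma> j q \<in> set P" using Cons.prems closed by auto
        obtain v where v: "set v \<subseteq> set J" "j # u q \<simeq> u (\<sigma> j q) @ v"
          using edge[of q j] Cons.prems by (auto simp: harmless_def)
        obtain v' where v': "set v' \<subseteq> set J" "rev w @ u (\<sigma> j q) \<simeq> u (act (rev w) (\<sigma> j q)) @ v'"
          using Cons.IH[OF q'] Cons.prems by auto
        have "rev w @ (j # u q) @ [] \<simeq> rev w @ (u (\<sigma> j q) @ v) @ []"
          using Cons.prems IS by (intro word_eq_context v(2)) auto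
        also have "\<dots> = [] @ (rev w @ u (\<sigma> j q)) @ v"
          by simp
        also have "\<dots> \<simeq> [] @ (u (act (rev w) (\<sigma> j q)) @ v') @ v"
          using v JS by (intro word_eq_context v'(2)) auto
        finally show ?case
          using v(1) v'(1) by (intro exI[of _ "v' @ v"]) simp
      qed
      \<comment> \<open>The relator of \<open>i\<close> and the tree label, without its leading \<open>i\<close>; it has odd length and equals \<open>i\<close>.\<close>
      let ?W = "alternating (2 * m i (par p) - 1) (par p) i"
      have alt_set: "set (alternating n s t) \<subseteq> {s, t}" for n and s t :: 'a
        by (induction n s t rule: alternating.induct) auto
      have "path_known \<sigma> T (dep p) p ?W"
        using vertex[OF p] less.prems 3(2) by (auto simp: list_all_iff dep_def)
      moreover have "set ?W \<subseteq> set I"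
        using alt_set[of "2 * m i (par p) - 1" "par p" i] par_I[OF p] less.prems by blast
      ultimately obtain v where v: "set v \<subseteq> set J" "rev ?W @ u p \<simeq> u (act (rev ?W) p) @ v"
        using path p by blast
      have W: "rev ?W \<simeq> [i]"
        using iS par_I[OF p] IS by (intro word_eq_alternating) auto
      have "[] @ [i] @ u p \<simeq> [] @ rev ?W @ u p"
        using u_S p by (intro word_eq_context word_eq_sym[OF W]) auto
      also have "[] @ rev ?W @ u p \<simeq> u (act (rev ?W) p) @ v"
        using v(2) by simp
      also have "act (rev ?W) p = \<sigma> i p"
        using word_eq_act[OF W] by (simp add: fun_eq_iff)
      finally show ?thesis
        unfolding harmless_def using v(1) by auto
    qed
  qed
  have harmless: "harmless p i" if "p \<in> set P" "i \<in> set I" for p i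
  proof (cases "dep (\<sigma> i p) \<le> dep p")
    case False
    then have "harmless (\<sigma> i p) i"
      using down[of "\<sigma> i p" i] that closed inv by simp
    then show ?thesis
      using harmless_sym[of "\<sigma> i p" i] that closed inv by simp
  qed (use down that in blast)
  have "act w x \<in> set P \<and> (\<exists>v. set v \<subseteq> set J \<and> w \<simeq> u (act w x) @ v)"
    using w(1)
  proof (induction w)
    case Nil
    then show ?case using x u_x by (intro conjI exI[of _ "[]"]) (auto simp: word_eq_refl)
  next
    case (Cons i w)
    then obtain v where v: "set v \<subseteq> set J" "w \<simeq> u (act w x) @ v" and P: "act w x \<in> set P"
      by auto
    have i: "i \<in> set I" using Cons.prems by simp
    obtain v' where v': "set v' \<subseteq> set J" "i # u (act w x) \<simeq> u (\<sigma> i (act w x)) @ v'"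
      using harmless[OF P i] by (auto simp: harmless_def)
    have "i # w \<simeq> i # (u (act w x) @ v)"
      using i IS v(2) by (intro word_eq_Cons) auto
    also have "\<dots> = [] @ (i # u (act w x)) @ v"
      by simp
    also have "\<dots> \<simeq> [] @ (u (\<sigma> i (act w x)) @ v') @ v"
      using v JS by (intro word_eq_context v'(2)) auto
    finally show ?case
      using v(1) v'(1) P i closed by (auto intro!: exI[of _ "v' @ v"])
  qed
  then show ?thesis
    using w(2) u_x by auto
qed

end

section \<open>The reflection action of the Coxeter group of type H4\<close>

definition reflect :: "mat2 \<Rightarrow> mat2 \<Rightarrow> mat2" where "reflect r x = - (r * adj x * r)"

lemma reflect_reflect: "reflect r (reflect s x) = (r * adj s) * x * (adj s * r)"
  by (simp add: reflect_def adj_mult mult.assoc)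

text \<open>Simple roots of \<open>H\<^sub>4\<close> modulo the square root of 5: the traces of \<open>r\<^sub>i (adj r\<^sub>j)\<close> for consecutive
\<open>i\<close> and \<open>j\<close> are \<open>2\<close>, \<open>-1\<close>, \<open>-1\<close>, and \<open>0\<close> for all other pairs. The coordinates are chosen such that the roots
1, 2, 3 have trace zero, that is, such that the first three reflections fix \<open>1\<close>, and such that the
left multiplications in \<open>act_coxeter_sixth_power\<close> and \<open>act_conjugate_coxeter_sixth_power\<close> are by triangular matrices.\<close>

fun simple_root :: "nat \<Rightarrow> mat2" where
  "simple_root i = (if i = 1 then Mat Z0 Z2 Z2 Z0 else if i = 2 then Mat Z1 Z3 Z1 Z4
  else if i = 3 then Mat Z3 Z0 Z0 Z2 else Mat Z0 Z1 Z4 Z3)"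
declare simple_root.simps [simp del]

definition simple_reflection :: "nat \<Rightarrow> mat2 \<Rightarrow> mat2" where
  "simple_reflection i = reflect (simple_root i)"

lemma simple_root_SL25: "simple_root i \<in> SL25"
  by (simp add: simple_root.simps SL25_def minus_z5_def one_z5_def)

lemma simple_reflection_SL25: "x \<in> SL25 \<Longrightarrow> simple_reflection i x \<in> SL25"
  by (simp add: simple_reflection_def reflect_def SL25_closed simple_root_SL25)

lemma coxeter_matrix_H4_code [code]:
  "coxeter_matrix_H4 i j = (if i = j then 1
     else if i = 1 \<and> j = 2 \<or> i = 2 \<and> j = 1 then 5
     else if i = 2 \<and> j = 3 \<or> i = 3 \<and> j = 2 \<or> i = 3 \<and> j = 4 \<or> i = 4 \<and> j = 3 then 3 else 2)"
  by (auto simp: coxeter_matrix_H4_def doubleton_eq_iff)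

lemma foldr_reflection_pair_power:
  "foldr simple_reflection (concat (replicate n [i, j])) x =
     (simple_root i * adj (simple_root j)) ^ n * x * (adj (simple_root j) * simple_root i) ^ n"
proof (induction n)
  case (Suc n)
  then show ?case
    by (simp add: simple_reflection_def reflect_reflect mult.assoc power_commutes)
qed simp

text \<open>By the preceding lemma a relator acts as \<open>x \<mapsto> P x Q\<close> for the two powers computed here, which are
equal and central.\<close>

lemma relator_powers:
  "list_all (\<lambda>i. list_all (\<lambda>j.
     ((simple_root i * adj (simple_root j)) ^ coxeter_matrix_H4 i j,
      (adj (simple_root j) * simple_root i) ^ coxeter_matrix_H4 i j) \<in> {(1, 1), (-1, -1)}) [1,2,3,4]) [1,2,3,4]"
  by code_simp

lemma generators_list: "{1..4::nat} = set [1,2,3,4]"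
  by auto

interpretation H4: coxeter_action "{1..4}" coxeter_matrix_H4 simple_reflection
proof
  fix i j :: nat and x assume "i \<in> {1..4}" "j \<in> {1..4}"
  then have "((simple_root i * adj (simple_root j)) ^ coxeter_matrix_H4 i j,
      (adj (simple_root j) * simple_root i) ^ coxeter_matrix_H4 i j) \<in> {(1, 1), (-1, -1)}"
    using relator_powers unfolding generators_list list_all_iff by blast
  then show "foldr simple_reflection (concat (replicate (coxeter_matrix_H4 i j) [i, j])) x = x"
    unfolding foldr_reflection_pair_power by auto
qed (auto simp: coxeter_matrix_H4_def)

section \<open>Faithfulness of the reflection action\<close>

text \<open>The tables are found by breadth-first search. They are stored as search trees indexed by the four
matrix entries, so that looking up a point takes a fixed number of rewrite steps; a negative
distance marks points that have not been reached.\<close>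

datatype 'a five = Five 'a 'a 'a 'a 'a

fun get :: "'a five \<Rightarrow> z5 \<Rightarrow> 'a" where
  "get (Five a b c d e) Z0 = a"
| "get (Five a b c d e) Z1 = b"
| "get (Five a b c d e) Z2 = c"
| "get (Five a b c d e) Z3 = d"
| "get (Five a b c d e) Z4 = e"

fun put :: "z5 \<Rightarrow> ('a \<Rightarrow> 'a) \<Rightarrow> 'a five \<Rightarrow> 'a five" where
  "put Z0 f (Five a b c d e) = Five (f a) b c d e"
| "put Z1 f (Five a b c d e) = Five a (f b) c d e"
| "put Z2 f (Five a b c d e) = Five a b (f c) d e"
| "put Z3 f (Five a b c d e) = Five a b c (f d) e"
| "put Z4 f (Five a b c d e) = Five a b c d (f e)"

type_synonym table = "(int \<times> nat) five five five five"

fun look :: "table \<Rightarrow> mat2 \<Rightarrow> int \<times> nat" where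
  "look T (Mat a b c d) = get (get (get (get T a) b) c) d"

fun enter :: "mat2 \<Rightarrow> int \<times> nat \<Rightarrow> table \<Rightarrow> table" where
  "enter (Mat a b c d) v T = put a (put b (put c (put d (\<lambda>_. v)))) T"

definition five_times :: "'a \<Rightarrow> 'a five" where "five_times a = Five a a a a a"

fun visit_unseen :: "bool \<Rightarrow> mat2 \<Rightarrow> int \<times> nat \<Rightarrow> table \<times> mat2 list \<Rightarrow> table \<times> mat2 list" where
  "visit_unseen True q v (T, ps) = (enter q v T, q # ps)"
| "visit_unseen False q v s = s"

fun visit :: "int \<Rightarrow> mat2 \<Rightarrow> nat \<Rightarrow> table \<times> mat2 list \<Rightarrow> table \<times> mat2 list" where
  "visit k p i (T, ps) = visit_unseen (fst (look T (simple_reflection i p)) < 0) (simple_reflection i p) (k, i) (T, ps)"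

text \<open>The list \<open>ps\<close> holds the points at distance \<open>k - 1\<close>; each round computes the next sphere.\<close>

fun search :: "nat list \<Rightarrow> nat \<Rightarrow> int \<Rightarrow> table \<times> mat2 list \<Rightarrow> table" where
  "search I 0 k (T, ps) = T"
| "search I (Suc n) k (T, ps) = search I n (k + 1) (fold (\<lambda>p. fold (visit k p) I) ps (T, []))"

definition search_tree :: "nat list \<Rightarrow> nat \<Rightarrow> mat2 \<Rightarrow> mat2 \<Rightarrow> int \<times> nat" where
  "search_tree I n x = look (search I n 1
     (enter x (0, 0) (five_times (five_times (five_times (five_times (-1, 0))))), [x]))"

definition reached :: "(mat2 \<Rightarrow> int \<times> nat) \<Rightarrow> mat2 list" where
  "reached T = filter (\<lambda>p. 0 \<le> fst (T p)) SL25_list"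

definition certified :: "nat list \<Rightarrow> nat list \<Rightarrow> mat2 \<Rightarrow> (mat2 \<Rightarrow> int \<times> nat) \<Rightarrow> bool" where
  "certified I J x T \<longleftrightarrow>
     table_ok simple_reflection coxeter_matrix_H4 T I J x (reached T) \<and>
     list_all (\<lambda>p. list_all (\<lambda>i. 0 \<le> fst (T (simple_reflection i p))) I) (reached T)"

lemma certified_stabilizer:
  assumes "certified I J x T" "x \<in> SL25" "set I \<subseteq> {1..4}" "set J \<subseteq> {1..4}"
    and "set w \<subseteq> set I" "H4.act w x = x"
  shows "\<exists>v. set v \<subseteq> set J \<and> H4.word_eq w v"
proof (rule H4.point_stabilizer_parabolic)
  show "table_ok simple_reflection coxeter_matrix_H4 T I J x (reached T)"
    using assms by (simp add: certified_def)
  then show "x \<in> set (reached T)"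
    using assms(2) by (simp add: table_ok_def reached_def set_SL25_list)
  show "simple_reflection i p \<in> set (reached T)" if "p \<in> set (reached T)" "i \<in> set I" for p i
    using that assms(1)
    by (auto simp: certified_def list_all_iff reached_def set_SL25_list simple_reflection_SL25)
qed (use assms in auto)

text \<open>The base points are chosen along the chain: \<open>1\<close> is orthogonal to the roots 1, 2, 3; the root 4 is
orthogonal to the roots 1, 2; the root 3 is orthogonal to the root 1; and the root 1 is negated by
its own reflection. Their orbits have 120, 12, 5 and 2 points, and the numbers of rounds are the
largest distances that occur in them.\<close>

lemma certified_H4: "certified [1,2,3,4] [1,2,3] 1 (search_tree [1,2,3,4] 45 1)"
  and certified_H3: "certified [1,2,3] [1,2] (simple_root 4) (search_tree [1,2,3] 10 (simple_root 4))"
  and certified_I2: "certified [1,2] [1] (simple_root 3) (search_tree [1,2] 4 (simple_root 3))"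
  and certified_A1: "certified [1] [] (simple_root 1) (search_tree [1] 1 (simple_root 1))"
  by code_simp+

text \<open>A word acting trivially fixes all four base points, so it can be pushed down the chain of
stabilizers until no letters are left.\<close>

theorem H4_action_faithful:
  assumes w: "set w \<subseteq> {1..4}" and triv: "\<And>x. x \<in> SL25 \<Longrightarrow> H4.act w x = x"
  shows "H4.word_eq w []"
proof -
  have subsets: "set [1,2,3,4] \<subseteq> {1..4::nat}" "set [1,2,3] \<subseteq> {1..4::nat}"
    "set [1,2] \<subseteq> {1..4::nat}" "set [1] \<subseteq> {1..4::nat}" "set [] \<subseteq> {1..4::nat}"
    by auto
  note fixed = triv[OF SL25_closed(4)] triv[OF simple_root_SL25]
  obtain w3 where w3: "set w3 \<subseteq> set [1,2,3]" "H4.word_eq w w3"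
    using certified_stabilizer[OF certified_H4 SL25_closed(4) subsets(1,2) w[unfolded generators_list] fixed(1)]
    by blast
  note fixed = fixed[unfolded H4.word_eq_act[OF w3(2)]]
  obtain w2 where w2: "set w2 \<subseteq> set [1,2]" "H4.word_eq w3 w2"
    using certified_stabilizer[OF certified_H3 simple_root_SL25 subsets(2,3) w3(1) fixed(2)] by blast
  note fixed = fixed[unfolded H4.word_eq_act[OF w2(2)]]
  obtain w1 where w1: "set w1 \<subseteq> set [1]" "H4.word_eq w2 w1"
    using certified_stabilizer[OF certified_I2 simple_root_SL25 subsets(3,4) w2(1) fixed(2)] by blast
  note fixed = fixed[unfolded H4.word_eq_act[OF w1(2)]]
  obtain w0 where w0: "set w0 \<subseteq> set []" "H4.word_eq w1 w0"
    using certified_stabilizer[OF certified_A1 simple_root_SL25 subsets(4,5) w1(1) fixed(2)] by blast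
  show ?thesis
    using H4.word_eq_trans[OF w3(2) H4.word_eq_trans[OF w2(2) H4.word_eq_trans[OF w1(2) w0(2)]]] w0(1)
    by simp
qed

section \<open>Two-sided multiplications\<close>

definition upper :: "z5 \<Rightarrow> mat2" where "upper t = Mat 1 t 0 1"
definition lower :: "z5 \<Rightarrow> mat2" where "lower t = Mat 1 0 t 1"

lemma act_even:
  "H4.act [i, j, k, l] x = (simple_root i * adj (simple_root j) * (simple_root k * adj (simple_root l))) * x *
     ((adj (simple_root l) * simple_root k) * (adj (simple_root j) * simple_root i))"
  by (simp add: simple_reflection_def reflect_reflect mult.assoc)

lemma act_replicate:
  assumes "\<And>x. H4.act w x = a * x * b"
  shows "H4.act (concat (replicate n w)) x = a ^ n * x * b ^ n"
  by (induction n) (simp_all add: assms mult.assoc power_commutes)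

text \<open>A Coxeter element of \<open>H\<^sub>4\<close> has order 30 and exponents 1, 11, 19, 29. It rotates two planes by 1/30
and 11/30 of a turn, so it is the product of a left and a right multiplication by elements that
rotate by the half sum 6/30 and the half difference 5/30. The left factor has order 5 and the right
factor order 6, and the sixth power is a pure left multiplication.\<close>

definition coxeter_sixth_power :: "nat list" where "coxeter_sixth_power = concat (replicate 6 [1, 2, 3, 4])"

lemma coxeter_left_right:
  "(simple_root 1 * adj (simple_root 2) * (simple_root 3 * adj (simple_root 4))) ^ 6 = upper Z1"
  "((adj (simple_root 4) * simple_root 3) * (adj (simple_root 2) * simple_root 1)) ^ 6 = 1"
  by code_simp+

lemma act_coxeter_sixth_power: "H4.act coxeter_sixth_power x = upper Z1 * x"
  unfolding coxeter_sixth_power_def using act_replicate[OF act_even, of 6 1 2 3 4 x]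
  by (simp only: coxeter_left_right mult_1_right)

lemma act_pair: "H4.act [i, j] x = (simple_root i * adj (simple_root j)) * x * (adj (simple_root j) * simple_root i)"
  by (simp add: simple_reflection_def reflect_reflect)

lemma conjugate_upper:
  "(simple_root 1 * adj (simple_root 3)) * upper Z1 * (simple_root 3 * adj (simple_root 1)) = lower Z4"
  "(adj (simple_root 1) * simple_root 3) * (adj (simple_root 3) * simple_root 1) = 1"
  by code_simp+

lemma act_conjugate_coxeter_sixth_power: "H4.act ([1, 3] @ coxeter_sixth_power @ [3, 1]) x = lower Z4 * x"
proof -
  have "H4.act ([1, 3] @ coxeter_sixth_power @ [3, 1]) x =
      ((simple_root 1 * adj (simple_root 3)) * upper Z1 * (simple_root 3 * adj (simple_root 1))) * x *
      ((adj (simple_root 1) * simple_root 3) * (adj (simple_root 3) * simple_root 1))"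
    by (simp only: foldr_append o_apply act_coxeter_sixth_power act_pair mult.assoc)
  then show ?thesis
    by (simp only: conjugate_upper mult_1_right)
qed

definition left_realized :: "mat2 set" where
  "left_realized = {a. \<exists>w. set w \<subseteq> {1..4} \<and> (\<forall>x. H4.act w x = a * x)}"

lemma left_realized_mult: "a \<in> left_realized \<Longrightarrow> b \<in> left_realized \<Longrightarrow> a * b \<in> left_realized"
proof -
  assume "a \<in> left_realized" "b \<in> left_realized"
  then obtain v w where "set v \<subseteq> {1..4}" "\<And>x. H4.act v x = a * x" "set w \<subseteq> {1..4}" "\<And>x. H4.act w x = b * x"
    by (auto simp: left_realized_def)
  then show ?thesis
    unfolding left_realized_def by (intro CollectI exI[of _ "v @ w"]) (simp add: mult.assoc)
qed

lemma left_realized_power: "a \<in> left_realized \<Longrightarrow> a ^ n \<in> left_realized"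
proof (induction n)
  case 0
  show ?case unfolding left_realized_def by (intro CollectI exI[of _ "[]"]) simp
qed (simp add: left_realized_mult)

lemma upper_lower_power: "list_all (\<lambda>t. \<exists>n\<in>{0..4}. upper t = upper Z1 ^ n) z5_list"
  "list_all (\<lambda>t. \<exists>n\<in>{0..4}. lower t = lower Z4 ^ n) z5_list"
  by code_simp+

text \<open>Gaussian elimination. If \<open>c = 0\<close>, adding the first row to the second makes the lower left entry \<open>a\<close>,
which is invertible, and reduces to the second case; this is undone by \<open>lower Z4\<close>.\<close>

lemma elementary_factorization: "list_all (\<lambda>x. case x of Mat a b c d \<Rightarrow>
   if c = 0 then x = lower Z4 * (upper ((a - 1) * inverse a) * lower a * upper ((b + d - 1) * inverse a))
   else x = upper ((a - 1) * inverse c) * lower c * upper ((d - 1) * inverse c)) SL25_list"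
  by code_simp

lemma SL25_left_realized: "SL25 \<subseteq> left_realized"
proof
  fix x assume x: "x \<in> SL25"
  have "set coxeter_sixth_power \<subseteq> {1..4}" "set ([1, 3] @ coxeter_sixth_power @ [3, 1]) \<subseteq> {1..4}"
    by (auto simp: coxeter_sixth_power_def)
  then have "upper Z1 \<in> left_realized" "lower Z4 \<in> left_realized"
    unfolding left_realized_def using act_coxeter_sixth_power act_conjugate_coxeter_sixth_power by blast+
  moreover have "(\<exists>n. upper t = upper Z1 ^ n) \<and> (\<exists>n. lower t = lower Z4 ^ n)" for t
    using upper_lower_power unfolding list_all_iff z5_list by blast
  ultimately have "upper t \<in> left_realized" "lower t \<in> left_realized" for t
    by (metis left_realized_power)+
  then have elementary: "upper r * lower s * upper t \<in> left_realized"
    "lower q * (upper r * lower s * upper t) \<in> left_realized" for q r s t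
    by (intro left_realized_mult; simp)+
  obtain a b c d where x_eq: "x = Mat a b c d" by (cases x)
  have "if c = 0 then x = lower Z4 * (upper ((a - 1) * inverse a) * lower a * upper ((b + d - 1) * inverse a))
      else x = upper ((a - 1) * inverse c) * lower c * upper ((d - 1) * inverse c)"
    using elementary_factorization x unfolding list_all_iff set_SL25_list x_eq by fastforce
  then show "x \<in> left_realized"
    using elementary by (cases "c = 0") simp_all
qed

text \<open>Right multiplications are conjugates of left multiplications under a reflection, because the
reflection contains the anti-automorphism \<open>adj\<close>.\<close>

lemma two_sided_realized:
  assumes "a \<in> SL25" "b \<in> SL25"
  shows "\<exists>w. set w \<subseteq> {1..4} \<and> (\<forall>x. H4.act w x = a * x * adj b)"
proof -
  let ?r = "simple_root 1"
  have "?r * b * adj ?r \<in> SL25"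
    using assms by (intro SL25_closed simple_root_SL25)
  then have "a \<in> left_realized" "?r * b * adj ?r \<in> left_realized"
    using SL25_left_realized assms(1) by auto
  then obtain v w where v: "set v \<subseteq> {1..4}" "\<And>x. H4.act v x = a * x"
    and w: "set w \<subseteq> {1..4}" "\<And>x. H4.act w x = (?r * b * adj ?r) * x"
    unfolding left_realized_def mem_Collect_eq by metis
  have "H4.act ([1] @ w @ [1]) x = x * adj b" for x
  proof -
    have "H4.act ([1] @ w @ [1]) x = (?r * adj ?r) * x * (adj ?r * ?r) * adj b * (adj ?r * ?r)"
      by (simp only: foldr_append foldr.simps o_apply id_apply w simple_reflection_def reflect_def adj_mult adj_adj
        adj_uminus mult_minus_left mult_minus_right minus_minus mult.assoc)
    then show ?thesis
      by (simp add: mult_adj simple_root_SL25)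
  qed
  then show ?thesis
    using v w by (intro exI[of _ "v @ [1] @ w @ [1]"]) (auto simp: mult.assoc)
qed

section \<open>Subgroups of SL(2,5) avoiding -1\<close>

definition companion :: "z5 \<Rightarrow> mat2" where "companion t = Mat 0 (- 1) 1 t"

fun frame :: "mat2 \<Rightarrow> mat2" where
  "frame (Mat a b c d) = (if c = 0 then Mat 0 b 1 d else Mat 1 a 0 c)"

fun mat_inverse :: "mat2 \<Rightarrow> mat2" where
  "mat_inverse (Mat a b c d) = (let e = inverse (a * d - b * c) in Mat (e * d) (- e * b) (- e * c) (e * a))"

text \<open>The elements of even order, those with a power equal to \<open>-1\<close>, are recognized by their trace.\<close>

lemma odd_trace_or_power: "list_all (\<lambda>x. trace2 x = Z2 \<or> trace2 x = Z4 \<or>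
    x * x = - 1 \<or> x * x * x = - 1 \<or> x * x * x * x * x = - 1) SL25_list"
  by code_simp

text \<open>A non-scalar matrix has a cyclic vector \<open>v\<close>; in the basis of \<open>v\<close> and its image, the matrix becomes the
companion matrix of its characteristic polynomial. The columns of \<open>frame x\<close> are such a basis, with a
unit vector for \<open>v\<close>: this only fails for diagonal \<open>x\<close>, and a diagonal matrix of determinant 1 and trace
\<open>2\<close> or \<open>-1\<close> is the identity.\<close>

lemma frame_companion: "list_all (\<lambda>x. (trace2 x = Z2 \<or> trace2 x = Z4) \<and> x \<noteq> 1 \<longrightarrow>
    frame x * mat_inverse (frame x) = 1 \<and> mat_inverse (frame x) * frame x = 1 \<and>
    mat_inverse (frame x) * x * frame x = companion (trace2 x)) SL25_list"
  by code_simp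

text \<open>Five powers are enough for elements of order 3 and of order 5.\<close>

definition powers :: "mat2 \<Rightarrow> mat2 list" where
  "powers u = [1, u, u * u, u * u * u, u * u * u * u]"

text \<open>A subgroup without \<open>-1\<close> only contains elements of trace \<open>2\<close> and \<open>-1\<close>, the identity having trace \<open>2\<close>. For
\<open>t = 2\<close> that is all that \<open>compatible\<close> says. For \<open>t = -1\<close>, elements of trace \<open>2\<close> other than the
identity are excluded as well.\<close>

definition compatible :: "z5 \<Rightarrow> mat2 \<Rightarrow> bool" where
  "compatible t y \<longleftrightarrow> y = 1 \<or> trace2 y = Z4 \<or> trace2 y = t"

definition confined :: "z5 \<Rightarrow> mat2 list \<Rightarrow> bool" where
  "confined t U \<longleftrightarrow> list_all (\<lambda>h. list_all (\<lambda>u. compatible t (u * h)) U \<longrightarrow> h \<in> set U) SL25_list"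

definition normalizer_list :: "mat2 \<Rightarrow> mat2 list \<Rightarrow> mat2 list" where
  "normalizer_list u U = filter (\<lambda>n. n * u * adj n \<in> set U) SL25_list"

text \<open>Let \<open>u\<close> be the companion matrix. For \<open>t = 2\<close> it is unipotent, so the trace of \<open>u\<^sup>k h\<close> is affine in \<open>k\<close>
and, omitting the value \<open>0\<close>, constant. Then \<open>h\<close> preserves the line fixed by \<open>u\<close>, its eigenvalues are
inverse to each other, and trace \<open>2\<close> or \<open>-1\<close> leaves only the eigenvalue \<open>1\<close>. For \<open>t = -1\<close>, the traces
of \<open>h\<close>, \<open>u h\<close> and \<open>u\<^sup>2 h\<close> add up to zero because \<open>1 + u + u\<^sup>2 = 0\<close>; they are not all \<open>-1\<close>, so one of
the three products is the identity.\<close>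

lemma confined_powers:
  "confined Z2 (powers (companion Z2))" "confined Z4 (powers (companion Z4))"
  by code_simp+

text \<open>The normalizers have order 20 and 12.\<close>

lemma normalizer_bound:
  "length (normalizer_list (companion Z2) (powers (companion Z2))) \<le> 24"
  "length (normalizer_list (companion Z4) (powers (companion Z4))) \<le> 24"
  by code_simp+

text \<open>By finiteness, closure under inverses is implied.\<close>

definition is_subgroup :: "mat2 set \<Rightarrow> bool" where
  "is_subgroup L \<longleftrightarrow> L \<subseteq> SL25 \<and> 1 \<in> L \<and> (\<forall>x\<in>L. \<forall>y\<in>L. x * y \<in> L)"

text \<open>Such a subgroup is cyclic of order 3 or 5. Pick \<open>g\<close> in it, of trace \<open>2\<close> if possible, and change the
basis such that \<open>g\<close> becomes a companion matrix; then the subgroup consists of the powers of \<open>g\<close>, and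
everything that normalizes it sends \<open>g\<close> to one of these powers.\<close>

lemma subgroup_avoiding_minus_one:
  assumes L: "is_subgroup L" "- 1 \<notin> L" "L \<noteq> {1}"
  shows "card L \<le> 5" and "card {n \<in> SL25. \<forall>x\<in>L. n * x * adj n \<in> L} \<le> 24"
proof -
  have sub: "x \<in> SL25" and mult: "y \<in> L \<Longrightarrow> x * y \<in> L" if "x \<in> L" for x y
    using that L by (auto simp: is_subgroup_def)
  have tr: "trace2 x = Z2 \<or> trace2 x = Z4" if "x \<in> L" for x
    using odd_trace_or_power sub[OF that] mult that L(2) unfolding list_all_iff set_SL25_list by metis
  obtain g where g: "g \<in> L" "g \<noteq> 1" and comp: "\<And>x. x \<in> L \<Longrightarrow> compatible (trace2 g) x"
  proof (cases "\<exists>g\<in>L. g \<noteq> 1 \<and> trace2 g = Z2")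
    case True
    then obtain g where "g \<in> L" "g \<noteq> 1" "trace2 g = Z2" by blast
    then show ?thesis using tr by (intro that[of g]) (auto simp: compatible_def)
  next
    case False
    moreover obtain g where "g \<in> L" "g \<noteq> 1" using L by (auto simp: is_subgroup_def)
    ultimately show ?thesis using that[of g] tr by (auto simp: compatible_def)
  qed
  define P where "P = frame g"
  define P' where "P' = mat_inverse P"
  define t where "t = trace2 g"
  have t: "t = Z2 \<or> t = Z4" using tr g by (simp add: t_def)
  have PP: "P * P' = 1" "P' * P = 1" and conj: "P' * g * P = companion t"
    using frame_companion sub[OF g(1)] g t unfolding list_all_iff set_SL25_list P_def P'_def t_def by auto
  define \<kappa> where "\<kappa> x = P' * x * P" for x
  have \<kappa>_mult: "\<kappa> (x * y) = \<kappa> x * \<kappa> y" for x y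
    using PP by (simp add: \<kappa>_def mult.assoc) (metis mult.assoc mult_1_left)
  have \<kappa>_1: "\<kappa> 1 = 1" using PP by (simp add: \<kappa>_def)
  have \<kappa>_inj: "inj \<kappa>"
  proof (rule injI)
    fix x y assume "\<kappa> x = \<kappa> y"
    then have "P * \<kappa> x * P' = P * \<kappa> y * P'" by simp
    moreover have "P * \<kappa> z * P' = z" for z
      using PP by (simp add: \<kappa>_def mult.assoc) (metis mult.assoc mult_1_left)
    ultimately show "x = y" by simp
  qed
  have \<kappa>_trace: "trace2 (\<kappa> x) = trace2 x" for x
  proof -
    have cyc: "trace2 (a * b) = trace2 (b * a)" for a b
      by (cases a; cases b) (simp add: algebra_simps)
    show ?thesis
      using PP cyc[of P' "x * P"] by (simp add: \<kappa>_def mult.assoc)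
  qed
  have \<kappa>_SL: "\<kappa> x \<in> SL25" if "x \<in> SL25" for x
  proof -
    have "det2 P * det2 P' = 1"
      using arg_cong[OF PP(1), of det2] SL25_closed(4) by (simp add: SL25_def)
    then show ?thesis
      using that by (simp add: SL25_def \<kappa>_def mult.commute)
  qed
  have \<kappa>_adj: "\<kappa> (adj x) = adj (\<kappa> x)" if "x \<in> SL25" for x
  proof -
    have "\<kappa> x * \<kappa> (adj x) = 1"
      using that by (simp add: \<kappa>_1 mult_adj flip: \<kappa>_mult)
    then have "adj (\<kappa> x) * (\<kappa> x * \<kappa> (adj x)) = adj (\<kappa> x)" by simp
    then show ?thesis
      using mult_adj(2)[OF \<kappa>_SL[OF that]] by (simp flip: mult.assoc)
  qed
  let ?U = "powers (companion t)"
  have U_L: "set ?U \<subseteq> \<kappa> ` L"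
    using L g mult \<kappa>_1 conj unfolding powers_def \<kappa>_def[symmetric] is_subgroup_def
    by (auto simp flip: conj \<kappa>_mult simp: \<kappa>_def[symmetric])
  have "confined t ?U" using confined_powers t by auto
  then have L_U: "\<kappa> ` L \<subseteq> set ?U"
  proof (intro image_subsetI)
    fix x assume "confined t ?U" "x \<in> L"
    have "compatible t (u * \<kappa> x)" if u: "u \<in> set ?U" for u
    proof -
      obtain y where y: "y \<in> L" "u = \<kappa> y" using U_L u by blast
      have "compatible t (y * x)" using comp mult[OF y(1) \<open>x \<in> L\<close>] by (simp add: t_def)
      then show ?thesis
        using \<kappa>_1 unfolding y by (auto simp: compatible_def \<kappa>_trace simp flip: \<kappa>_mult)
    qed
    then show "\<kappa> x \<in> set ?U"
      using \<open>confined t ?U\<close> \<kappa>_SL[OF sub[OF \<open>x \<in> L\<close>]]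
      by (auto simp: confined_def list_all_iff set_SL25_list)
  qed
  have "card L = card (\<kappa> ` L)"
    by (rule card_image[OF inj_on_subset[OF \<kappa>_inj subset_UNIV], symmetric])
  also have "\<dots> \<le> card (set ?U)"
    using L_U by (intro card_mono) auto
  also have "\<dots> \<le> 5"
    using card_length[of ?U] by (simp add: powers_def)
  finally show "card L \<le> 5" .
  let ?N = "{n \<in> SL25. \<forall>x\<in>L. n * x * adj n \<in> L}"
  have sub_N: "\<kappa> ` ?N \<subseteq> set (normalizer_list (companion t) ?U)"
  proof (intro image_subsetI)
    fix n assume n: "n \<in> ?N"
    then have "\<kappa> (n * g * adj n) \<in> set ?U" using g L_U by blast
    then show "\<kappa> n \<in> set (normalizer_list (companion t) ?U)"
      using n conj by (simp add: normalizer_list_def set_SL25_list \<kappa>_mult \<kappa>_adj \<kappa>_SL flip: conj \<kappa>_def)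
  qed
  have bound: "length (normalizer_list (companion t) ?U) \<le> 24"
    using t normalizer_bound by (elim disjE) (simp_all only:)
  have "card (\<kappa> ` ?N) \<le> card (set (normalizer_list (companion t) ?U))"
    using sub_N by (rule card_mono[OF List.finite_set])
  also have "\<dots> \<le> 24"
    by (rule le_trans[OF card_length bound])
  also have "card (\<kappa> ` ?N) = card ?N"
    by (rule card_image[OF inj_on_subset[OF \<kappa>_inj subset_UNIV]])
  finally show "card ?N \<le> 24" .
qed

text \<open>Let \<open>L1\<close> and \<open>L2\<close> be the intersections of \<open>H\<close> with the factors. If one of them is trivial, \<open>H\<close> embeds
into the other factor. Otherwise \<open>card H\<close> is the order of the first projection of \<open>H\<close>, which normalizes
\<open>L1\<close>, times the order of \<open>L2\<close>, hence at most \<open>24 * 5\<close>.\<close>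

lemma card_subgroup_avoiding_minus_one:
  assumes H: "H \<subseteq> SL25 \<times> SL25"
    and mult: "\<And>a b c d. (a, b) \<in> H \<Longrightarrow> (c, d) \<in> H \<Longrightarrow> (a * c, b * d) \<in> H"
    and inv: "\<And>a b. (a, b) \<in> H \<Longrightarrow> (adj a, adj b) \<in> H"
    and one: "(1, 1) \<in> H"
    and avoid: "(- 1, 1) \<notin> H" "(1, - 1) \<notin> H"
  shows "card H \<le> 120"
proof -
  define L1 L2 where "L1 = {a. (a, 1) \<in> H}" and "L2 = {b. (1, b) \<in> H}"
  have SL: "a \<in> SL25" "b \<in> SL25" if "(a, b) \<in> H" for a b using that H by auto
  have L: "is_subgroup L1" "is_subgroup L2" "- 1 \<notin> L1" "- 1 \<notin> L2"
    using one avoid SL mult[of _ 1 _ 1] mult[of 1 _ 1] by (auto simp: is_subgroup_def L1_def L2_def)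
  consider "L1 = {1}" | "L2 = {1}" | "L1 \<noteq> {1}" "L2 \<noteq> {1}" by blast
  then show ?thesis
  proof cases
    case 1
    have "inj_on snd H"
    proof (rule inj_onI, clarsimp)
      fix a a' b assume "(a, b) \<in> H" "(a', b) \<in> H"
      then have "a * adj a' \<in> L1"
        using mult[OF _ inv, of a b a' b] SL[of a b] by (simp add: L1_def mult_adj)
      then have "a * adj a' * a' = a'" using 1 by simp
      then show "a = a'" using mult_adj SL[OF \<open>(a', b) \<in> H\<close>] by (simp add: mult.assoc)
    qed
    then have "card H \<le> card SL25"
      using H finite_SL25 by (intro card_inj_on_le[of snd]) auto
    then show ?thesis by (simp add: card_SL25)
  next
    case 2
    have "inj_on fst H"
    proof (rule inj_onI, clarsimp)
      fix a b b' assume "(a, b) \<in> H" "(a, b') \<in> H"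
      then have "b * adj b' \<in> L2"
        using mult[OF _ inv, of a b a b'] SL[of a b] by (simp add: L2_def mult_adj)
      then have "b * adj b' * b' = b'" using 2 by simp
      then show "b = b'" using mult_adj SL[OF \<open>(a, b') \<in> H\<close>] by (simp add: mult.assoc)
    qed
    then have "card H \<le> card SL25"
      using H finite_SL25 by (intro card_inj_on_le[of fst]) auto
    then show ?thesis by (simp add: card_SL25)
  next
    case 3
    let ?N = "{n \<in> SL25. \<forall>x\<in>L1. n * x * adj n \<in> L1}"
    \<comment> \<open>Dividing by a fixed partner \<open>s a\<close> of \<open>a\<close> moves the second component into \<open>L2\<close>.\<close>
    define s where "s a = (SOME b. (a, b) \<in> H)" for a
    have s: "(a, s a) \<in> H" if "(a, b) \<in> H" for a b
      unfolding s_def using that by (rule someI)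
    let ?f = "\<lambda>(a, b). (a, adj (s a) * b)"
    have "inj_on ?f H"
    proof (rule inj_onI, clarsimp)
      fix a b b' assume h: "(a, b) \<in> H" "(a, b') \<in> H" "adj (s a) * b = adj (s a) * b'"
      then have "s a * adj (s a) * b = s a * adj (s a) * b'" by (simp add: mult.assoc)
      then show "b = b'" using mult_adj SL[OF s[OF h(1)]] by simp
    qed
    moreover have "?f ` H \<subseteq> ?N \<times> L2"
    proof (clarsimp, intro conjI ballI)
      fix a b assume h: "(a, b) \<in> H"
      show "a \<in> SL25" using SL h by blast
      show "adj (s a) * b \<in> L2"
        using mult[OF inv[OF s[OF h]] h] SL[OF h] by (simp add: L2_def mult_adj)
      fix x assume "x \<in> L1"
      then show "a * x * adj a \<in> L1"
        using mult[OF mult[OF h, of x 1] inv[OF h]] SL[OF h] by (simp add: L1_def mult_adj)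
    qed
    moreover have "finite (?N \<times> L2)"
      using finite_SL25 L(2) by (auto simp: is_subgroup_def intro: finite_subset)
    ultimately have "card H \<le> card (?N \<times> L2)"
      by (rule card_inj_on_le)
    also have "\<dots> \<le> 24 * 5"
      unfolding card_cartesian_product
      using subgroup_avoiding_minus_one(2)[OF L(1,3) 3(1)] subgroup_avoiding_minus_one(1)[OF L(2,4) 3(2)] by (rule mult_le_mono)
    finally show ?thesis by simp
  qed
qed

section \<open>Embedding into the symmetric group on 120 points\<close>

lemma mon_sym_group_of_faithful_action:
  assumes G: "group G" and X: "finite X" "card X = n"
    and closed: "\<And>g x. g \<in> carrier G \<Longrightarrow> x \<in> X \<Longrightarrow> \<phi> g x \<in> X"
    and one: "\<And>x. x \<in> X \<Longrightarrow> \<phi> \<one>\<^bsub>G\<^esub> x = x"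
    and mult: "\<And>g h x. g \<in> carrier G \<Longrightarrow> h \<in> carrier G \<Longrightarrow> x \<in> X \<Longrightarrow> \<phi> (g \<otimes>\<^bsub>G\<^esub> h) x = \<phi> g (\<phi> h x)"
    and faithful: "\<And>g. g \<in> carrier G \<Longrightarrow> (\<And>x. x \<in> X \<Longrightarrow> \<phi> g x = x) \<Longrightarrow> g = \<one>\<^bsub>G\<^esub>"
  shows "mon G (sym_group n) \<noteq> {}"
proof -
  interpret G: group G by (rule G)
  obtain e where e: "bij_betw e {1..n} X"
    using ex_bij_betw_nat_finite_1[OF X(1)] X(2) by auto
  define e' where "e' = inv_into {1..n} e"
  have e': "e' x \<in> {1..n}" "e (e' x) = x" if "x \<in> X" for x
    using that bij_betw_imp_surj_on[OF e] bij_betw_inv_into_right[OF e] inv_into_into[of x e "{1..n}"]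
    by (simp_all add: e'_def del: atLeastAtMost_iff)
  have ee: "e k \<in> X" "e' (e k) = k" if "k \<in> {1..n}" for k
    using that e unfolding e'_def by (auto simp: bij_betw_def)
  define \<pi> where "\<pi> g k = (if k \<in> {1..n} then e' (\<phi> g (e k)) else k)" for g k
  have range: "\<pi> g k \<in> {1..n}" if "g \<in> carrier G" "k \<in> {1..n}" for g k
    using e'(1)[OF closed[OF that(1) ee(1)[OF that(2)]]] that by (simp add: \<pi>_def)
  have hom: "\<pi> (g \<otimes>\<^bsub>G\<^esub> h) = \<pi> g \<circ> \<pi> h" if "g \<in> carrier G" "h \<in> carrier G" for g h
  proof
    fix k
    show "\<pi> (g \<otimes>\<^bsub>G\<^esub> h) k = (\<pi> g \<circ> \<pi> h) k"
    proof (cases "k \<in> {1..n}")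
      case True
      then show ?thesis
        using range[OF that(2) True] that ee[OF True] e'(2)[OF closed[OF that(2) ee(1)[OF True]]]
        by (simp add: \<pi>_def mult del: atLeastAtMost_iff)
    qed (simp add: \<pi>_def del: atLeastAtMost_iff)
  qed
  have id: "\<pi> \<one>\<^bsub>G\<^esub> = id"
    by (rule ext) (simp add: \<pi>_def one ee del: atLeastAtMost_iff)
  have perm: "\<pi> g permutes {1..n}" if g: "g \<in> carrier G" for g
  proof -
    have "\<pi> g \<circ> \<pi> (inv\<^bsub>G\<^esub> g) = id" "\<pi> (inv\<^bsub>G\<^esub> g) \<circ> \<pi> g = id"
      using g by (simp_all add: id flip: hom)
    then have "bij (\<pi> g)" by (metis o_bij)
    then show ?thesis
      unfolding permutes_def by (auto simp: \<pi>_def bij_iff simp del: atLeastAtMost_iff)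
  qed
  have "\<pi> \<in> hom G (sym_group n)"
    by (auto simp: hom_def sym_group_def perm hom simp del: One_nat_def)
  moreover have "g = \<one>\<^bsub>G\<^esub>" if g: "g \<in> carrier G" "\<pi> g = id" for g
  proof (rule faithful[OF g(1)])
    fix x assume x: "x \<in> X"
    have "e' (\<phi> g x) = e' x"
      using fun_cong[OF g(2), of "e' x"] e'[OF x] by (simp add: \<pi>_def del: atLeastAtMost_iff)
    then show "\<phi> g x = x" using e'(2) x closed[OF g(1) x] by metis
  qed
  ultimately have "\<pi> \<in> mon G (sym_group n)"
    using G sym_group_is_group by (auto simp: mon_iff_hom_one sym_group_one)
  then show ?thesis by blast
qed

definition H4_class :: "nat list \<Rightarrow> nat word set" where
  "H4_class w = word_cong {1..4} (coxeter_relators {1..4} coxeter_matrix_H4) `` {H4.positive w}"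

text \<open>The action of a class is that of any representative, by \<open>W_action_class\<close>.\<close>

definition W_action :: "nat word set \<Rightarrow> mat2 \<Rightarrow> mat2" where
  "W_action A = H4.act (map fst (SOME u. u \<in> A))"

lemma carrier_W_H4: "carrier W_H4 = {H4_class w | w. set w \<subseteq> {1..4}}"
proof (intro equalityI subsetI)
  let ?R = "word_cong {1..4} (coxeter_relators {1..4} coxeter_matrix_H4)"
  fix A assume "A \<in> carrier W_H4"
  then obtain u where u: "u \<in> words {1..4}" "A = ?R `` {u}"
    by (auto simp: W_H4_def coxeter_group_def presented_group_def elim!: quotientE)
  have "A = H4_class (map fst u)"
    unfolding H4_class_def u(2)
    by (rule equiv_class_eq[OF equiv_word_cong H4.word_cong_positive[OF u(1)]])
  moreover have "set (map fst u) \<subseteq> {1..4}"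
    using u(1) by (auto simp: words_def)
  ultimately show "A \<in> {H4_class w | w. set w \<subseteq> {1..4}}" by blast
next
  fix A assume "A \<in> {H4_class w | w. set w \<subseteq> {1..4}}"
  then obtain w where "set w \<subseteq> {1..4}" "A = H4_class w" by blast
  then show "A \<in> carrier W_H4"
    by (simp only: W_H4_def coxeter_group_def presented_group_def H4_class_def monoid.simps
        partial_object.simps quotientI H4.positive_words)
qed

lemma H4_class_mult:
  assumes "set u \<subseteq> {1..4}" "set v \<subseteq> {1..4}"
  shows "H4_class u \<otimes>\<^bsub>W_H4\<^esub> H4_class v = H4_class (u @ v)"
proof -
  have "H4.positive u @ H4.positive v = H4.positive (u @ v)"
    by (simp add: H4.positive_def)
  then show ?thesis
    unfolding H4_class_def W_H4_def coxeter_group_def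
    using presented_group_mult[of "H4.positive u" "{1..4}" "H4.positive v"] assms H4.positive_words by metis
qed

lemma one_W_H4: "\<one>\<^bsub>W_H4\<^esub> = H4_class []"
  by (simp add: W_H4_def coxeter_group_def presented_group_def H4_class_def H4.positive_def)

lemma H4_class_eq: "H4.word_eq u v \<Longrightarrow> H4_class u = H4_class v"
  unfolding H4_class_def H4.word_eq_def by (rule equiv_class_eq[OF equiv_word_cong])

lemma W_action_class:
  assumes "set w \<subseteq> {1..4}"
  shows "W_action (H4_class w) = H4.act w"
proof -
  have "H4.positive w \<in> H4_class w"
    using assms H4.positive_words[of w] by (auto simp: H4_class_def intro: word_cong.refl)
  then have "(SOME u. u \<in> H4_class w) \<in> H4_class w" by (rule someI)
  then have "(H4.positive w, SOME u. u \<in> H4_class w) \<in> word_cong {1..4} (coxeter_relators {1..4} coxeter_matrix_H4)"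
    by (simp add: H4_class_def)
  from H4.word_cong_act[OF this] show ?thesis
    by (simp add: W_action_def)
qed

lemma W_action_mult:
  assumes "g \<in> carrier W_H4" "h \<in> carrier W_H4"
  shows "W_action (g \<otimes>\<^bsub>W_H4\<^esub> h) x = W_action g (W_action h x)"
proof -
  obtain u v where "set u \<subseteq> {1..4}" "g = H4_class u" "set v \<subseteq> {1..4}" "h = H4_class v"
    using assms unfolding carrier_W_H4 by blast
  moreover from this have "set (u @ v) \<subseteq> {1..4}" by simp
  ultimately show ?thesis
    by (simp only: H4_class_mult W_action_class foldr_append o_apply)
qed

lemma W_action_one: "W_action \<one>\<^bsub>W_H4\<^esub> x = x"
  by (simp add: one_W_H4 W_action_class)

lemma W_action_closed: "g \<in> carrier W_H4 \<Longrightarrow> x \<in> SL25 \<Longrightarrow> W_action g x \<in> SL25"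
proof -
  have "H4.act w x \<in> SL25" if "x \<in> SL25" for w
    using that by (induction w) (auto simp: simple_reflection_SL25)
  moreover assume "g \<in> carrier W_H4" "x \<in> SL25"
  ultimately show ?thesis unfolding carrier_W_H4 by (auto simp: W_action_class simp del: One_nat_def)
qed

lemma W_action_faithful:
  assumes "g \<in> carrier W_H4" "\<And>x. x \<in> SL25 \<Longrightarrow> W_action g x = x"
  shows "g = \<one>\<^bsub>W_H4\<^esub>"
proof -
  obtain w where w: "set w \<subseteq> {1..4}" "g = H4_class w"
    using assms(1) unfolding carrier_W_H4 by blast
  then have "H4.word_eq w []"
    using assms(2) W_action_class[OF w(1)] by (intro H4_action_faithful) auto
  then show ?thesis
    using w by (simp only: one_W_H4 H4_class_eq)
qed

lemma W_H4_embeds_Sym_120: "mon W_H4 (sym_group 120) \<noteq> {}"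
  using mon_sym_group_of_faithful_action[OF group_W_H4 finite_SL25 card_SL25, of W_action]
    W_action_closed W_action_one W_action_mult W_action_faithful by blast

section \<open>Faithful permutation representations need 120 points\<close>

lemma two_sided_element:
  assumes "a \<in> SL25" "b \<in> SL25"
  shows "\<exists>g\<in>carrier W_H4. \<forall>x. W_action g x = a * x * adj b"
proof -
  obtain w where "set w \<subseteq> {1..4}" "\<And>x. H4.act w x = a * x * adj b"
    using two_sided_realized[OF assms] by blast
  then show ?thesis
    unfolding carrier_W_H4 by (intro bexI[of _ "H4_class w"]) (auto simp only: W_action_class)
qed

text \<open>Via \<open>\<theta>\<close>, the group \<open>SL(2,5) \<times> SL(2,5)\<close> acts on the points through \<open>F\<close>. As \<open>\<theta>\<close> only
identifies pairs that differ by a common sign, \<open>F (-1) 1\<close> is not the identity, and the stabilizer of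
a point that it moves has at most 120 elements; counting the fibres of the orbit map gives
\<open>120 * 120 \<le> n * 120\<close>.\<close>

lemma faithful_degree_ge_120:
  assumes \<psi>: "\<psi> \<in> mon W_H4 (sym_group n)"
  shows "120 \<le> n"
proof -
  interpret W: group W_H4 by (rule group_W_H4)
  have hom: "\<psi> (g \<otimes>\<^bsub>W_H4\<^esub> h) = \<psi> g \<circ> \<psi> h" if "g \<in> carrier W_H4" "h \<in> carrier W_H4" for g h
    using \<psi> that by (auto simp: mon_def hom_def sym_group_def)
  have perm: "\<psi> g permutes {1..n}" if "g \<in> carrier W_H4" for g
    using \<psi> that by (auto simp: mon_def hom_def sym_group_def)
  have inj: "g = h" if "g \<in> carrier W_H4" "h \<in> carrier W_H4" "\<psi> g = \<psi> h" for g h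
    using \<psi> that by (auto simp: mon_def inj_on_def)
  have unique: "g = h" if "g \<in> carrier W_H4" "h \<in> carrier W_H4"
    and "\<And>x. W_action g x = W_action h x" for g h
  proof -
    have "g \<otimes>\<^bsub>W_H4\<^esub> inv\<^bsub>W_H4\<^esub> h = \<one>\<^bsub>W_H4\<^esub>"
    proof (rule W_action_faithful)
      fix x
      have "W_action (g \<otimes>\<^bsub>W_H4\<^esub> inv\<^bsub>W_H4\<^esub> h) x = W_action h (W_action (inv\<^bsub>W_H4\<^esub> h) x)"
        using that by (simp add: W_action_mult)
      also have "\<dots> = W_action (h \<otimes>\<^bsub>W_H4\<^esub> inv\<^bsub>W_H4\<^esub> h) x"
        using that by (subst W_action_mult) simp_all
      also have "\<dots> = x"
        using that by (simp add: W_action_one)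
      finally show "W_action (g \<otimes>\<^bsub>W_H4\<^esub> inv\<^bsub>W_H4\<^esub> h) x = x" .
    qed (use that in simp)
    then show ?thesis using that W.inv_equality[of g "inv\<^bsub>W_H4\<^esub> h"] by simp
  qed
  define \<theta> where "\<theta> a b = (SOME g. g \<in> carrier W_H4 \<and> (\<forall>x. W_action g x = a * x * adj b))" for a b
  have \<theta>: "\<theta> a b \<in> carrier W_H4" "W_action (\<theta> a b) x = a * x * adj b" if "a \<in> SL25" "b \<in> SL25" for a b x
  proof -
    have "\<theta> a b \<in> carrier W_H4 \<and> (\<forall>x. W_action (\<theta> a b) x = a * x * adj b)"
      unfolding \<theta>_def by (rule someI_ex) (use two_sided_element[OF that] in blast)
    then show "\<theta> a b \<in> carrier W_H4" "W_action (\<theta> a b) x = a * x * adj b" by auto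
  qed
  define F where "F a b = \<psi> (\<theta> a b)" for a b
  have F_perm: "F a b permutes {1..n}" if "a \<in> SL25" "b \<in> SL25" for a b
    using that by (simp add: F_def perm \<theta> del: One_nat_def)
  have F_mult: "F (a * c) (b * d) = F a b \<circ> F c d"
    if "a \<in> SL25" "b \<in> SL25" "c \<in> SL25" "d \<in> SL25" for a b c d
  proof -
    have "\<theta> (a * c) (b * d) = \<theta> a b \<otimes>\<^bsub>W_H4\<^esub> \<theta> c d"
      using that by (intro unique) (simp_all add: \<theta> SL25_closed W_action_mult adj_mult mult.assoc)
    then show ?thesis using that by (simp add: F_def hom \<theta>)
  qed
  have F_1: "F 1 1 = id"
  proof -
    have idem: "F 1 1 \<circ> F 1 1 = F 1 1" using F_mult[of 1 1 1 1] SL25_closed by simp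
    have inj: "inj (F 1 1)" by (rule permutes_inj[OF F_perm[OF SL25_closed(4) SL25_closed(4)]])
    show ?thesis
      by (rule ext) (use fun_cong[OF idem] inj in \<open>simp add: inj_eq\<close>)
  qed
  have adj_1: "adj 1 = 1" "adj (- 1) = - 1" by (simp_all add: one_mat2_def)
  have "F (- 1) 1 \<noteq> id"
  proof
    assume "F (- 1) 1 = id"
    then have "\<theta> (- 1) 1 = \<theta> 1 1"
      using F_1 by (intro inj) (simp_all add: F_def \<theta> SL25_closed)
    then have "- 1 * 1 * adj 1 = 1 * 1 * adj (1::mat2)"
      using \<theta>(2)[of "-1" 1 1] \<theta>(2)[of 1 1 1] SL25_closed by metis
    then show False by (simp add: adj_1) (simp add: one_mat2_def one_z5_def)
  qed
  then obtain k where k: "F (- 1) 1 k \<noteq> k" by (auto simp: fun_eq_iff)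
  have kn: "k \<in> {1..n}"
    using k F_perm[of "- 1" 1] SL25_closed by (metis permutes_not_in)
  define H where "H = {(a, b). a \<in> SL25 \<and> b \<in> SL25 \<and> F a b k = k}"
  have H_inv: "(adj a, adj b) \<in> H" if "(a, b) \<in> H" for a b
  proof -
    have "F (adj a) (adj b) \<circ> F a b = id"
      using that F_mult[of "adj a" "adj b" a b] by (auto simp: H_def SL25_closed mult_adj F_1)
    then have "F (adj a) (adj b) (F a b k) = k" by (simp add: fun_eq_iff)
    then show ?thesis using that by (auto simp: H_def SL25_closed)
  qed
  have "card H \<le> 120"
  proof (rule card_subgroup_avoiding_minus_one)
    show "H \<subseteq> SL25 \<times> SL25" by (auto simp: H_def)
    show "(a * c, b * d) \<in> H" if "(a, b) \<in> H" "(c, d) \<in> H" for a b c d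
      using that by (auto simp: H_def SL25_closed F_mult)
    show "(1, 1) \<in> H" by (simp add: H_def SL25_closed F_1)
    show "(- 1, 1) \<notin> H" using k by (simp add: H_def)
    \<comment> \<open>\<open>(1, -1)\<close> and \<open>(-1, 1)\<close> both induce \<open>x \<mapsto> - x\<close>.\<close>
    have "\<theta> 1 (- 1) = \<theta> (- 1) 1"
      by (intro unique) (simp_all add: \<theta> SL25_closed adj_1)
    then show "(1, - 1) \<notin> H" using k by (simp add: H_def F_def)
  qed (rule H_inv)
  have fibre: "card {p \<in> SL25 \<times> SL25. case_prod F p k = j} \<le> card H" for j
  proof (cases "{p \<in> SL25 \<times> SL25. case_prod F p k = j} = {}")
    case False
    then obtain a b where ab: "a \<in> SL25" "b \<in> SL25" "F a b k = j" by auto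
    \<comment> \<open>Translation by the inverse of one element of the fibre.\<close>
    let ?f = "\<lambda>(c, d). (adj a * c, adj b * d)"
    have cancel: "a * (adj a * x) = x" "b * (adj b * x) = x" for x
      using mult_adj(1)[OF ab(1)] mult_adj(1)[OF ab(2)] by (simp_all flip: mult.assoc)
    have "inj ?f"
      by (rule injI, clarsimp) (metis cancel)
    moreover have "?f ` {p \<in> SL25 \<times> SL25. case_prod F p k = j} \<subseteq> H"
    proof (rule image_subsetI)
      fix p assume "p \<in> {p \<in> SL25 \<times> SL25. case_prod F p k = j}"
      then obtain c d where cd: "p = (c, d)" "c \<in> SL25" "d \<in> SL25" "F c d k = j" by auto
      have "F (adj a) (adj b) (F a b k) = k"
        using fun_cong[OF F_mult[of "adj a" "adj b" a b], of k] ab by (simp add: SL25_closed mult_adj F_1)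
      then show "?f p \<in> H"
        using ab cd by (simp add: H_def SL25_closed F_mult)
    qed
    moreover have "finite H"
      using finite_SL25 by (intro finite_subset[of H "SL25 \<times> SL25"]) (auto simp: H_def)
    ultimately show ?thesis
      by (intro card_inj_on_le[of ?f]) (auto intro: inj_on_subset)
  qed (simp only: card.empty le0)
  have "case_prod F p k \<in> {1..n}" if "p \<in> SL25 \<times> SL25" for p
    using that kn F_perm by (cases p) (simp add: permutes_in_image del: atLeastAtMost_iff One_nat_def)
  then have "SL25 \<times> SL25 = (\<Union>j\<in>{1..n}. {p \<in> SL25 \<times> SL25. case_prod F p k = j})"
    by blast
  then have "card (SL25 \<times> SL25) \<le> (\<Sum>j\<in>{1..n}. card {p \<in> SL25 \<times> SL25. case_prod F p k = j})"
    using card_UN_le[of "{1..n}" "\<lambda>j. {p \<in> SL25 \<times> SL25. case_prod F p k = j}"] by simp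
  also have "\<dots> \<le> (\<Sum>j\<in>{1..n}. 120)"
    using fibre \<open>card H \<le> 120\<close> by (intro sum_mono) (meson le_trans)
  finally show ?thesis
    by (simp add: card_cartesian_product card_SL25)
qed

theorem proposition4p18:
  shows "min_faithful_perm_degree W_H4 = 120"
  unfolding min_faithful_perm_degree_def
proof (rule Least_equality)
  show "mon W_H4 (sym_group 120) \<noteq> {}" by (rule W_H4_embeds_Sym_120)
qed (use faithful_degree_ge_120 in blast)

end
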